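(* Let $t>0$ and $m\in\{0,1\}$. For $\alpha=1$ (exponential random time $G_1(t)$), $$P\left\{X_m(G_1(t))\in dx\right\}=dx\int_0^{ct}\frac{t^2}{2y}\,e^{-\frac{t^2|x|}{y}}\,q^m(y,t)\,dy,\qquad x\in\mathbb{R},$$ where $q^m(y,t)=2p^m(y,t)$.
   Context: Fix $c>0$, $\lambda>0$. For $m\in\{0,1\}$ let $X_m(s)=c\sum_{j=1}^{N(s)+1}(s_j-s_{j-1})\cos\theta_j$, where $N$ is a homogeneous Poisson process of rate $\lambda$ with event times $s_1<s_2<\cdots$, $s_0=0$, $s_{N(s)+1}=s$, and the $\theta_j$ are i.i.d. (independent of $N$) with density $\frac{\Gamma(m+1)}{\sqrt\pi\,\Gamma(m+\frac12)}\sin^{2m}\theta$ on $(0,\pi)$. For an integer $n\ge0$ put $v_0=\frac n2$, $v_1=n+1$ and let $p_n^m(x,s)$ be the density of $X_m(s)$ given $N(s)=n$; explicitly $p_n^m(x,s)=\frac{\Gamma(v_m)\Gamma(v_m+1)}{2\pi\Gamma(2v_m)}\left(\frac{2}{cs}\right)^{2v_m}(c^2s^2-x^2)^{v_m-\frac12}$ for $|x|<cs$ and $0$ otherwise, with $\Gamma(v)/\Gamma(2v)$ read as $2$ when $v=0$. The density of $X_m(t)$ is $p^m(\cdot,t)$, given for $|x|<ct$ by $p^0(x,t)=\frac{\lambda e^{-\lambda t}}{2c}\sum_{k=0}^{\infty}\left(\frac{\lambda}{2c}\sqrt{c^2t^2-x^2}\right)^{k-1}\frac{1}{\Gamma^2(\frac{k+1}{2})}$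 and $p^1(x,t)=\frac{e^{-\lambda t}}{c\sqrt{\lambda\pi t^3}}\sum_{k=0}^{\infty}\left(\frac{\lambda}{c^2t}(c^2t^2-x^2)\right)^{k+\frac12}\frac{k+1}{\Gamma(k+\frac32)}$. $G_1(t)$ is an exponential random variable with density $te^{-ts}$, $s>0$, independent of $X_m$ and $N$. For an independent positive random time $T$ (depending on the parameter $t$), the conditional law is $P\{X_m(T)\in dx\,|\,N(t)=n\}=dx\int_0^\infty p_n^m(x,s)\,P\{T\in ds\}$, and the unconditional law is $P\{X_m(T)\in dx\}=\sum_{n=0}^\infty e^{-\lambda t}\frac{(\lambda t)^n}{n!}P\{X_m(T)\in dx\,|\,N(t)=n\}$ (the number of Poisson events is that of the interval $[0,t]$). Equalities of laws are equalities of Lebesgue densities (a.e. $x$). *)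

theory Defs
  imports "HOL-Probability.Probability"
begin

text \<open>\<open>S k\<close> is the time of the \<open>k\<close>-th Poisson event, with \<open>S 0 = 0\<close>.\<close>

definition event_count :: "(nat \<Rightarrow> 'a \<Rightarrow> real) \<Rightarrow> real \<Rightarrow> 'a \<Rightarrow> nat" where
  "event_count S s \<omega> = card {k. 1 \<le> k \<and> S k \<omega> \<le> s}"

definition flight ::
    "real \<Rightarrow> (nat \<Rightarrow> 'a \<Rightarrow> real) \<Rightarrow> (nat \<Rightarrow> 'a \<Rightarrow> real) \<Rightarrow> real \<Rightarrow> 'a \<Rightarrow> real" where
  "flight c S \<theta> s \<omega> =
     c * (\<Sum>j = 1..event_count S s \<omega> + 1.
            ((if j = event_count S s \<omega> + 1 then s else S j \<omega>) - S (j - 1) \<omega>) * cos (\<theta> j \<omega>))"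

definition angle_density :: "nat \<Rightarrow> real \<Rightarrow> real" where
  "angle_density m x =
     (if 0 < x \<and> x < pi
      then Gamma (real m + 1) / (sqrt pi * Gamma (real m + 1/2)) * sin x ^ (2 * m) else 0)"

text \<open>The homogeneous Poisson process of rate \<open>lam\<close> is given by its event times, whose
  increments are i.i.d. exponential; strict monotonicity of the event times then holds
  almost surely. The counting process is a function of the event times, so independence of
  the angles from the process is expressed as independence from the event times.\<close>

locale random_flight = prob_space M
  for M :: "'a measure" +
  fixes m :: nat and c lam :: real
    and S :: "nat \<Rightarrow> 'a \<Rightarrow> real" and \<theta> :: "nat \<Rightarrow> 'a \<Rightarrow> real"
  assumes c_pos: "0 < c" and rate_pos: "0 < lam"
    and S_0: "\<And>\<omega>. \<omega> \<in> space M \<Longrightarrow> S 0 \<omega> = 0"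
    and waiting_indep: "indep_vars (\<lambda>_. borel) (\<lambda>k \<omega>. S (Suc k) \<omega> - S k \<omega>) UNIV"
    and waiting_distr:
      "\<And>k. distributed M lborel (\<lambda>\<omega>. S (Suc k) \<omega> - S k \<omega>) (exponential_density lam)"
    and angle_indep: "indep_vars (\<lambda>_. borel) \<theta> {1..}"
    and angle_distr: "\<And>j. 1 \<le> j \<Longrightarrow> distributed M lborel (\<theta> j) (angle_density m)"
    and angle_event_indep:
      "indep_var (Pi\<^sub>M {1..} (\<lambda>_. borel)) (\<lambda>\<omega>. \<lambda>j\<in>{1..}. \<theta> j \<omega>)
                 (Pi\<^sub>M UNIV (\<lambda>_. borel)) (\<lambda>\<omega> k. S k \<omega>)"

text \<open>The density \<open>p\<^sup>m(x,t)\<close> of the flight at time \<open>t\<close>, meant for \<open>m \<in> {0, 1}\<close>; on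
  \<open>\<bar>x\<bar> < c t\<close> all bases of \<open>powr\<close> are positive.\<close>

definition flight_density :: "nat \<Rightarrow> real \<Rightarrow> real \<Rightarrow> real \<Rightarrow> real \<Rightarrow> real" where
  "flight_density m c lam x t =
     (if \<bar>x\<bar> < c * t then
        if m = 0 then
          lam * exp (- (lam * t)) / (2 * c) *
          (\<Sum>k. (lam / (2 * c) * sqrt (c\<^sup>2 * t\<^sup>2 - x\<^sup>2)) powr (real k - 1)
                  * (1 / (Gamma ((real k + 1) / 2))\<^sup>2))
        else
          exp (- (lam * t)) / (c * sqrt (lam * pi * t ^ 3)) *
          (\<Sum>k. (lam / (c\<^sup>2 * t) * (c\<^sup>2 * t\<^sup>2 - x\<^sup>2)) powr (real k + 1/2)
                  * ((real k + 1) / Gamma (real k + 3/2)))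
      else 0)"

definition folded_density :: "nat \<Rightarrow> real \<Rightarrow> real \<Rightarrow> real \<Rightarrow> real \<Rightarrow> real" where
  "folded_density m c lam y t = 2 * flight_density m c lam y t"

text \<open>\<open>P{X(T) \<in> A | N(t) = n}\<close>: by convention, the mixture over \<open>s\<close>, distributed as \<open>T\<close>, of
  the conditional laws of \<open>X(s)\<close> given \<open>N(s) = n\<close>, i.e. the integral over \<open>A\<close> of
  \<open>\<integral> p\<^sub>n(x,s) P{T \<in> ds}\<close> with \<open>p\<^sub>n(\<cdot>,s)\<close> the density of \<open>X(s)\<close> given \<open>N(s) = n\<close>.\<close>

definition cond_prob_at_random_time ::
    "'a measure \<Rightarrow> (real \<Rightarrow> 'a \<Rightarrow> real) \<Rightarrow> (real \<Rightarrow> 'a \<Rightarrow> nat)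
      \<Rightarrow> ('a \<Rightarrow> real) \<Rightarrow> nat \<Rightarrow> real set \<Rightarrow> ennreal" where
  "cond_prob_at_random_time M X N T n A =
     (\<integral>\<^sup>+ s. ennreal (\<P>(\<omega> in M. X s \<omega> \<in> A \<bar> N s \<omega> = n)) \<partial>distr M borel T)"

text \<open>\<open>P{X(T) \<in> A}\<close>: the number of Poisson events is that of the interval \<open>[0,t]\<close>, so this is
  in general not the law of \<open>\<omega> \<mapsto> X (T \<omega>) \<omega>\<close>.\<close>

definition prob_at_random_time ::
    "'a measure \<Rightarrow> real \<Rightarrow> real \<Rightarrow> (real \<Rightarrow> 'a \<Rightarrow> real) \<Rightarrow> (real \<Rightarrow> 'a \<Rightarrow> nat)
      \<Rightarrow> ('a \<Rightarrow> real) \<Rightarrow> real set \<Rightarrow> ennreal"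
  where
  "prob_at_random_time M lam t X N T A =
     (\<Sum>n. ennreal (exp (- (lam * t)) * (lam * t) ^ n / fact n)
             * cond_prob_at_random_time M X N T n A)"

end

theory Submission
  imports Defs
begin

text \<open>
  Given \<open>N(s) = n\<close>, the normalised position \<open>W = X(s) / (c s)\<close> is symmetric with density proportional to
  \<open>(1 - w\<^sup>2)\<close> to the power \<open>v - 1/2\<close>, where \<open>v = n/2\<close> for \<open>m = 0\<close> and \<open>v = n + 1\<close> for \<open>m = 1\<close>; the law of \<open>W\<close>
  does not depend on \<open>s\<close>. Both sides of the theorem are then Poisson mixtures over \<open>n\<close> which agree
  by Tonelli and the linear substitutions \<open>x = c s w\<close> and \<open>y = c t w\<close>.

  The law of \<open>W\<close> is identified by its moments. If \<open>J(z)\<close> is the ordinary generating function of the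
  moments of \<open>cos \<theta>\<close>, adding one leg at a time shows that the \<open>k\<close>-th moment of \<open>W\<close> is
  \<open>k! n! / (n + k)!\<close> times the \<open>k\<close>-th coefficient of the \<open>(n + 1)\<close>-st power of \<open>J\<close>: powers \<open>x\<^sup>j / j!\<close>
  convolve like monomials multiply. Since \<open>J\<close> is \<open>(1 - z\<^sup>2)\<close> to the power \<open>-1/2\<close> for \<open>m = 0\<close> and
  \<open>2 (1 - sqrt (1 - z\<^sup>2)) / z\<^sup>2\<close> for \<open>m = 1\<close>, its powers satisfy a linear differential equation, and the
  resulting recurrence is the one that integration by parts yields for the moments of the claimed density.
\<close>

section \<open>Moments determine a bounded distribution\<close>

text \<open>Given n events in [0,s], the n + 1 leg lengths are uniform on a simplex, so the mean of
  a product of their powers with exponents k_0, ..., k_n summing to k is s^k n! k_0! ... k_n! / (n +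
  k)!. Multinomial coefficients cancel the k_i!; hence the factor k! n! / (n + k)! and a plain power
  of J. Order statistics are never invoked: integrating out one waiting time after another produces
  the same factorials.

  The final identity rests on one match of scales. For fixed w > 0 the product c T w is exponential
  with mean c w / t, and with y = c t w this mean is y / t^2, because the same t is the rate of T
  and the time of the flight. By symmetry of W the half w > 0 alone determines the density at x > 0,
  so no factor 2 appears: the one in q cancels the 1/2 of the kernel.

  The two series with Gamma coefficients are not tested for convergence. Their terms are nonnegative
  and have total mass 1, hence they are summable almost everywhere, which suffices for an equality
  of densities.\<close>

lemma char_bounded_moment_series:
  assumes "real_distribution M" and bd: "AE x in M. \<bar>x\<bar> \<le> B"
  shows "(\<lambda>n. \<Sum>k\<le>n. ((\<i> * of_real t) ^ k / fact k) * of_real (\<integral>x. x ^ k \<partial>M)) \<longlonglongrightarrow> char M t"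
proof -
  interpret real_distribution M by fact
  have int: "integrable M (\<lambda>x. x ^ k)" and le: "(\<integral>x. \<bar>x\<bar> ^ k \<partial>M) \<le> B ^ k" for k
  proof -
    have ae: "AE x in M. \<bar>x\<bar> ^ k \<le> B ^ k"
      using bd by eventually_elim (rule power_mono, auto)
    show "integrable M (\<lambda>x. x ^ k)"
      by (rule integrable_const_bound[of _ "B ^ k"]) (use ae in \<open>auto simp: power_abs\<close>)
    show "(\<integral>x. \<bar>x\<bar> ^ k \<partial>M) \<le> B ^ k"
      by (rule integral_le_const) (use ae in \<open>auto intro!: integrable_const_bound[of _ "B ^ k"]\<close>)
  qed
  \<comment> \<open>The Taylor remainder is controlled by the n-th absolute moment, here at most
    \<open>B ^ n\<close>; the division by n! makes it vanish in the limit for every t.\<close>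
  have "cmod (char M t - (\<Sum>k\<le>n. ((\<i> * of_real t) ^ k / fact k) * of_real (\<integral>x. x ^ k \<partial>M)))
      \<le> 2 * ((\<bar>t\<bar> * B) ^ n / fact n)" for n
  proof -
    have "cmod (char M t - (\<Sum>k\<le>n. ((\<i> * of_real t) ^ k / fact k) * of_real (\<integral>x. x ^ k \<partial>M)))
      \<le> (2 * \<bar>t\<bar> ^ n / fact n) * (\<integral>x. \<bar>x\<bar> ^ n \<partial>M)"
      by (rule char_approx1) (rule int)
    also have "\<dots> \<le> (2 * \<bar>t\<bar> ^ n / fact n) * B ^ n"
      by (intro mult_left_mono le) auto
    finally show ?thesis by (simp add: power_mult_distrib)
  qed
  then have "(\<lambda>n. char M t - (\<Sum>k\<le>n. ((\<i> * of_real t) ^ k / fact k) * of_real (\<integral>x. x ^ k \<partial>M)))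
      \<longlonglongrightarrow> 0"
  proof (rule Lim_null_comparison[OF always_eventually, rule_format])
    have "(\<lambda>n. 2 * (inverse (fact n) * (\<bar>t\<bar> * B) ^ n)) \<longlonglongrightarrow> 0"
      by (intro tendsto_mult_right_zero summable_LIMSEQ_zero summable_exp)
    then show "(\<lambda>n. 2 * ((\<bar>t\<bar> * B) ^ n / fact n)) \<longlonglongrightarrow> 0"
      by (simp add: divide_inverse mult.commute)
  qed
  from tendsto_diff[OF tendsto_const[of "char M t"] this] show ?thesis by simp
qed

lemma real_distribution_eqI_moments:
  assumes "real_distribution M1" "real_distribution M2"
    and "AE x in M1. \<bar>x\<bar> \<le> B" "AE x in M2. \<bar>x\<bar> \<le> B"
    and mom: "\<And>k. (\<integral>x. x ^ k \<partial>M1) = (\<integral>x. x ^ k \<partial>M2)"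
  shows "M1 = M2"
proof (rule Levy_uniqueness[OF assms(1,2)], rule ext)
  show "char M1 t = char M2 t" for t
    using char_bounded_moment_series[OF assms(1,3), of t] char_bounded_moment_series[OF assms(2,4), of t]
    unfolding mom by (rule LIMSEQ_unique)
qed

section \<open>Powers of the moment generating series\<close>

text \<open>Moments of the Gegenbauer weight (1 - w^2)^(v - 1/2), normalised to mass 1: consecutive
  even moments are Beta integrals with the stated ratio. The case v = 0 is the arcsine law, v = 1
  the semicircle law.\<close>

fun gegenbauer_moment :: "real \<Rightarrow> nat \<Rightarrow> real" where
  "gegenbauer_moment v 0 = 1"
| "gegenbauer_moment v (Suc 0) = 0"
| "gegenbauer_moment v (Suc (Suc k)) =
    (real k + 1) / (real k + 2 * v + 2) * gegenbauer_moment v k"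

definition gegenbauer_fps :: "real \<Rightarrow> real fps" where
  "gegenbauer_fps v = Abs_fps (gegenbauer_moment v)"

text \<open>Serves to recognise three families: scaled series coefficients, integrals against the
  density, and means of powers of cos. The recurrence is free of division, the form in which
  integration by parts delivers it; \<open>0 \<le> v\<close> keeps its leading factor
  positive.\<close>

lemma gegenbauer_momentI:
  assumes "0 \<le> v" and "f 0 = 1" "f (Suc 0) = 0"
    and rec: "\<And>k. (real k + 2 * v + 2) * f (Suc (Suc k)) = (real k + 1) * f k"
  shows "f k = gegenbauer_moment v k"
proof (induction k rule: induct_nat_012)
  case (ge2 k)
  have "real k + 2 * v + 2 > 0" using assms(1) by simp
  then have "f (Suc (Suc k)) = (real k + 1) / (real k + 2 * v + 2) * f k"
    using rec[of k] by (simp add: field_simps)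
  then show ?case using ge2 by simp
qed (use assms(2,3) in simp_all)

lemma fps_deriv_X2 [simp]: "fps_deriv ((fps_X :: real fps)\<^sup>2) = 2 * fps_X"
  by (simp add: power2_eq_square)

lemma fps_nth_mult_X2:
  fixes F :: "real fps"
  shows "fps_nth (fps_X\<^sup>2 * F) n = (if n < 2 then 0 else fps_nth F (n - 2))"
  by (rule fps_X_power_mult_nth)

text \<open>The Euler operator z d/dz is diagonal on coefficients, so the equations for J, R and F
  are written with it and become recurrences at once.\<close>

lemma fps_X_deriv_nth [simp]: "fps_nth (fps_X * fps_deriv F) n = real n * fps_nth F n"
  for F :: "real fps"
  by (cases n) auto

lemma fps_nth_power_01:
  fixes J :: "real fps"
  assumes "fps_nth J 0 = 1" "fps_nth J 1 = 0"
  shows "fps_nth (J ^ n) 0 = 1 \<and> fps_nth (J ^ n) (Suc 0) = 0"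
  using assms by (induction n) (auto simp: fps_mult_nth)

text \<open>From k to k + 2 the factor k! n! / (n + k)! is multiplied by (k + 1)(k + 2) / ((n + k +
  1)(n + k + 2)). This cancels k + 2 on the left of \<open>rec\<close> and both factors on its
  right, leaving the moment recurrence.\<close>

lemma gegenbauer_moment_of_coeff_recurrence:
  fixes F :: "real fps"
  assumes "0 \<le> v" "fps_nth F 0 = 1" "fps_nth F (Suc 0) = 0"
    and rec: "\<And>k. (real k + 2) * (real k + 2 * v + 2) * fps_nth F (k + 2)
      = (real n + real k + 1) * (real n + real k + 2) * fps_nth F k"
  shows "fps_nth F k * fact k * fact n / fact (n + k) = gegenbauer_moment v k"
proof (rule gegenbauer_momentI)
  fix k
  have "(real k + 2 * v + 2) * (fps_nth F (Suc (Suc k)) * fact (Suc (Suc k)) * fact n / fact (n + Suc (Suc k)))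
     = ((real k + 2) * (real k + 2 * v + 2) * fps_nth F (k + 2)) * (real k + 1) * fact k * fact n
        / ((real n + real k + 2) * (real n + real k + 1) * fact (n + k))"
    by (simp add: algebra_simps)
  also have "\<dots> = (real k + 1) * (fps_nth F k * fact k * fact n / fact (n + k))"
    unfolding rec by (simp add: divide_simps)
  finally show "(real k + 2 * v + 2) * (fps_nth F (Suc (Suc k)) * fact (Suc (Suc k)) * fact n / fact (n + Suc (Suc k)))
    = (real k + 1) * (fps_nth F k * fact k * fact n / fact (n + k))" .
qed (use assms in auto)

text \<open>Since J is a power of 1 - z^2, so is J^(n+1), and it obeys the equation of J with the
  source multiplied by n + 1. The resulting \<open>rec1\<close> becomes the required recurrence
  after multiplication by n + k + 2, which is k + 2 v + 2 at v = n/2.\<close>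

lemma gegenbauer_fps_power_0:
  "fps_nth (gegenbauer_fps 0 ^ Suc n) k * fact k * fact n / fact (n + k) = gegenbauer_moment (n / 2) k"
proof -
  define J where "J = gegenbauer_fps 0"
  define F where "F = J ^ Suc n"
  have J01: "fps_nth J 0 = 1" "fps_nth J 1 = 0"
    by (simp_all add: J_def gegenbauer_fps_def)
  have odeJ: "fps_X * fps_deriv J = fps_X\<^sup>2 * (fps_X * fps_deriv J) + fps_X\<^sup>2 * J"
  proof (rule fps_ext)
    fix k show "fps_nth (fps_X * fps_deriv J) k = fps_nth (fps_X\<^sup>2 * (fps_X * fps_deriv J) + fps_X\<^sup>2 * J) k"
    proof (cases "k < 2")
      case False
      then obtain j where "k = Suc (Suc j)"
        by (metis Suc_1 add_2_eq_Suc le_Suc_ex not_less)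
      then show ?thesis unfolding fps_add_nth fps_nth_mult_X2 fps_X_deriv_nth
        by (simp add: J_def gegenbauer_fps_def field_simps)
    qed (use J01 in \<open>auto simp: fps_nth_mult_X2 less_2_cases_iff\<close>)
  qed
  define d where "d = fps_X * fps_deriv J"
  define C :: "real fps" where "C = fps_const (real (Suc n))"
  have DF: "fps_X * fps_deriv F = C * (J ^ n * d)"
    unfolding F_def fps_deriv_power d_def C_def by (simp add: mult_ac)
  have odeF: "fps_X * fps_deriv F = fps_X\<^sup>2 * (fps_X * fps_deriv F) + fps_X\<^sup>2 * (C * F)"
  proof -
    have "C * (J ^ n * d) = C * (J ^ n * (fps_X\<^sup>2 * d + fps_X\<^sup>2 * J))"
      using odeJ by (simp add: d_def)
    also have "\<dots> = fps_X\<^sup>2 * (C * (J ^ n * d)) + fps_X\<^sup>2 * (C * F)"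
      by (simp add: F_def algebra_simps)
    finally show ?thesis unfolding DF .
  qed
  have rec1: "(real k + 2) * fps_nth F (k + 2) = (real n + real k + 1) * fps_nth F k" for k
    using arg_cong[OF odeF, of "\<lambda>F. fps_nth F (k + 2)"]
    unfolding fps_add_nth fps_nth_mult_X2 fps_X_deriv_nth C_def fps_mult_left_const_nth
    by (simp add: algebra_simps)
  show ?thesis
    unfolding J_def[symmetric] F_def[symmetric]
  proof (rule gegenbauer_moment_of_coeff_recurrence)
    show "fps_nth F 0 = 1" "fps_nth F (Suc 0) = 0"
      using fps_nth_power_01[OF J01, of "Suc n"] unfolding F_def by auto
    fix k
    have "(real k + 2) * (real k + 2 * (real n / 2) + 2) * fps_nth F (k + 2)
        = (real n + real k + 2) * ((real k + 2) * fps_nth F (k + 2))" by (simp add: mult_ac add_ac)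
    also have "\<dots> = (real n + real k + 1) * (real n + real k + 2) * fps_nth F k"
      unfolding rec1 by (simp add: mult_ac)
    finally show "(real k + 2) * (real k + 2 * (real n / 2) + 2) * fps_nth F (k + 2)
        = (real n + real k + 1) * (real n + real k + 2) * fps_nth F k" .
  qed simp
qed

text \<open>\<open>1 - fps_X\<^sup>2\<close> solves the equation itself, so the quotient of Q by it
  has derivative 0. This identifies the square of a series without a formal square root.\<close>

lemma fps_one_minus_X2_ode_unique:
  fixes Q :: "real fps"
  assumes "fps_nth Q 0 = 1"
    and ode: "(1 - fps_X\<^sup>2) * fps_deriv Q = - (2 * fps_X * Q)"
  shows "Q = 1 - fps_X\<^sup>2"
proof -
  define P :: "real fps" where "P = 1 - fps_X\<^sup>2"
  have P0: "fps_nth P 0 = 1" by (simp add: P_def)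
  have inv: "inverse P * P = 1" by (rule inverse_mult_eq_1) (simp add: P0)
  have dP: "fps_deriv P = - (2 * fps_X)" by (simp add: P_def)
  define H where "H = Q * inverse P"
  have QH: "Q = H * P" using inv by (simp add: H_def mult.assoc)
  have "P * (fps_deriv H * P + H * fps_deriv P) = - (2 * fps_X * (H * P))"
    using ode unfolding P_def[symmetric] QH fps_deriv_mult by (simp add: algebra_simps)
  then have "P * P * fps_deriv H = 0"
    unfolding dP by (simp add: algebra_simps)
  moreover have "P \<noteq> 0" using P0 by auto
  ultimately have "fps_deriv H = 0" by simp
  then obtain c where "H = fps_const c" unfolding fps_deriv_eq_0_iff by blast
  moreover have "fps_nth H 0 = 1"
    using arg_cong[OF QH, of "\<lambda>F. fps_nth F 0"] assms(1) P0 by simp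
  ultimately have "H = 1" by simp
  then show ?thesis using QH by (simp add: P_def)
qed

text \<open>The first-order equation \<open>R * G = C * F\<close> for the powers of J has the
  algebraic coefficient R. Applying z d/dz + (n + 1) once more and multiplying by R leaves only
  \<open>R\<^sup>2\<close> and R times z R', both polynomials, so a second-order equation with
  polynomial coefficients remains.\<close>

lemma gegenbauer_fps_power_1:
  "fps_nth (gegenbauer_fps 1 ^ Suc n) k * fact k * fact n / fact (n + k)
    = gegenbauer_moment (real n + 1) k"
proof -
  define J where "J = gegenbauer_fps 1"
  define F where "F = J ^ Suc n"
  have J01: "fps_nth J 0 = 1" "fps_nth J 1 = 0"
    by (simp_all add: J_def gegenbauer_fps_def)
  define h :: "real fps" where "h = fps_const (1 / 2)"
  have h2: "h * 2 = 1" "2 * h = 1"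
    by (simp_all add: h_def numeral_fps_const fps_const_1_eq_1[symmetric] del: fps_const_1_eq_1)
  define x2 :: "real fps" where "x2 = fps_X\<^sup>2"
  txt \<open>\<open>R\<close> is the series of \<open>sqrt (1 - z\<^sup>2)\<close>; its first-order equation is the recurrence of \<open>J\<close>.\<close>
  define R where "R = 1 - h * x2 * J"
  define d where "d = fps_X * fps_deriv J"
  have dR: "fps_X * fps_deriv R = - (x2 * J + h * x2 * d)"
  proof -
    have "fps_X * fps_deriv R = - ((2 * h) * (x2 * J) + h * x2 * d)"
      unfolding R_def x2_def d_def by (simp add: h_def algebra_simps power2_eq_square)
    then show ?thesis using h2 by simp
  qed
  have odeR: "(1 - x2) * (fps_X * fps_deriv R) = - (x2 * R)"
  proof (rule fps_ext)
    have R: "fps_nth R k = (if k = 0 then 1 else if k = 1 then 0 else - fps_nth J (k - 2) / 2)" for k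
      by (auto simp: R_def mult.assoc fps_nth_mult_X2 h_def x2_def)
    fix k show "fps_nth ((1 - x2) * (fps_X * fps_deriv R)) k = fps_nth (- (x2 * R)) k"
    \<comment> \<open>R has two initial coefficients of its own and \<open>x2\<close> shifts by two
      more, so the recurrence of J applies from index 4 on.\<close>
    proof (cases "k < 4")
      case True
      then consider "k = 0" | "k = 1" | "k = 2" | "k = 3" by linarith
      then show ?thesis using J01 unfolding left_diff_distrib fps_sub_nth x2_def
        by cases (auto simp: fps_nth_mult_X2 R)
    next
      case False
      define j where "j = k - 4"
      have k: "k = Suc (Suc (Suc (Suc j)))" using False by (simp add: j_def)
      show ?thesis
        unfolding left_diff_distrib mult_1 fps_sub_nth fps_neg_nth x2_def fps_nth_mult_X2 fps_X_deriv_nth R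
        by (simp add: k J_def gegenbauer_fps_def field_simps)
    qed
  qed
  have R2: "R\<^sup>2 = 1 - x2" unfolding x2_def
  proof (rule fps_one_minus_X2_ode_unique)
    show "fps_nth (R\<^sup>2) 0 = 1" by (simp add: R_def power2_eq_square x2_def mult.assoc fps_nth_mult_X2)
    have "fps_X * ((1 - fps_X\<^sup>2) * fps_deriv (R\<^sup>2)) = 2 * R * ((1 - x2) * (fps_X * fps_deriv R))"
      by (simp add: power2_eq_square x2_def algebra_simps)
    also have "\<dots> = fps_X * (- (2 * fps_X * R\<^sup>2))"
      unfolding odeR by (simp add: x2_def power2_eq_square algebra_simps)
    finally show "(1 - fps_X\<^sup>2) * fps_deriv (R\<^sup>2) = - (2 * fps_X * R\<^sup>2)"
      by (subst (asm) mult_left_cancel) auto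
  qed
  have "fps_nth R 0 = 1" by (simp add: R_def x2_def mult.assoc)
  then have R0: "R \<noteq> 0" by auto
  \<comment> \<open>Written out in J, \<open>R\<^sup>2 = 1 - x2\<close> is x2 times the Catalan
    equation J = 1 + (z^2/4) J^2.\<close>
  have "x2 * (J - 1 - h * h * x2 * J\<^sup>2) = 0"
  proof -
    have "1 - x2 = 1 - (2 * h) * x2 * J + h * h * x2 * x2 * J\<^sup>2"
      unfolding R2[symmetric] R_def by (simp add: power2_eq_square algebra_simps)
    then show ?thesis using h2 by (simp add: algebra_simps)
  qed
  then have "J - 1 - h * h * x2 * J\<^sup>2 = 0"
    by (subst (asm) mult_eq_0_iff) (simp add: x2_def)
  then have quad: "h * h * x2 * J\<^sup>2 = J - 1"
    by (simp add: algebra_simps)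
  have RdR: "R * (fps_X * fps_deriv R) = - x2"
  proof -
    have "R * (R * (fps_X * fps_deriv R)) = R\<^sup>2 * (fps_X * fps_deriv R)"
      by (simp only: power2_eq_square mult.assoc)
    also have "\<dots> = R * (- x2)"
      unfolding R2 odeR by (simp add: mult_ac)
    finally have "R * (R * (fps_X * fps_deriv R)) = R * (- x2)" .
    then show ?thesis using R0 by (metis mult_left_cancel)
  qed
  \<comment> \<open>\<open>J + d\<close> is the derivative of z J. Here \<open>RdR\<close> yields R
    d = 2 - 2 R J, and \<open>quad\<close> yields R J = 2 - J.\<close>
  have RJ: "R * (J + d) = J"
  proof -
    have "x2 * (R * (J + h * d)) = x2 * 1"
      using RdR unfolding dR by (simp add: algebra_simps)
    then have "R * (J + h * d) = 1" by (subst (asm) mult_left_cancel) (auto simp: x2_def)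
    moreover have "R * (2 * J + (2 * h) * d) = 2 * (R * (J + h * d))" by (simp add: algebra_simps)
    ultimately have 1: "R * d = 2 - 2 * (R * J)"
      unfolding h2 by (simp add: algebra_simps)
    have "(2 * h) * (R * J) = (2 * h) * J - 2 * (h * h * x2 * J\<^sup>2)"
      unfolding R_def by (simp add: power2_eq_square algebra_simps)
    then have "R * J = 2 - J" unfolding h2 quad by (simp add: algebra_simps)
    moreover have "R * (J + d) = R * J + R * d" by (rule distrib_left)
    ultimately show ?thesis using 1 by simp
  qed
  define C :: "real fps" where "C = fps_const (real (Suc n))"
  define G where "G = fps_X * fps_deriv F + C * F"
  have DF: "fps_X * fps_deriv F = C * (J ^ n * d)"
    unfolding F_def fps_deriv_power d_def C_def by (simp add: mult_ac)
  have RG: "R * G = C * F"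
  proof -
    have "R * G = C * J ^ n * (R * (J + d))"
      unfolding G_def DF unfolding F_def power_Suc by (simp only: algebra_simps)
    then show ?thesis unfolding RJ F_def by (simp only: power_Suc mult_ac)
  qed
  define e where "e = fps_X * fps_deriv R"
  define g where "g = fps_X * fps_deriv G"
  \<comment> \<open>The operator z d/dz + (n + 1) applied to both sides of \<open>RG\<close>; on the
    right it turns C F into C G.\<close>
  have eg: "e * G + R * g + C * (R * G) = C * G"
  proof -
    have "e * G + R * g = fps_X * fps_deriv (R * G)"
      unfolding e_def g_def fps_deriv_mult by (simp only: algebra_simps)
    also have "\<dots> = C * (fps_X * fps_deriv F)"
      unfolding RG C_def fps_deriv_mult by (simp add: mult_ac)
    finally show ?thesis unfolding RG unfolding G_def by (simp only: algebra_simps)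
  qed
  have "(R * e) * G + R\<^sup>2 * (g + C * G) = R * (e * G + R * g + C * (R * G))"
    by (simp only: algebra_simps power2_eq_square)
  also have "\<dots> = C * (R * G)" unfolding eg by (simp only: mult_ac)
  finally have "- x2 * G + (1 - x2) * (g + C * G) = C * (C * F)"
    unfolding e_def RdR R2 RG .
  moreover have "g + C * G = (- x2 * G + (1 - x2) * (g + C * G)) + x2 * G + x2 * (g + C * G)"
    by (simp add: algebra_simps)
  ultimately have ode: "g + C * G = C * (C * F) + x2 * G + x2 * (g + C * G)"
    by simp
  have Gk: "fps_nth G k = (real k + real n + 1) * fps_nth F k" for k
    unfolding G_def fps_add_nth fps_X_deriv_nth C_def fps_mult_left_const_nth by (simp add: algebra_simps)
  \<comment> \<open>At index k + 2 the left factor is (k + n + 3)^2 - (n + 1)^2 = (k + 2)(k + 2 n +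
    4).\<close>
  have "(real k + 2) * (real k + 2 * (real n + 1) + 2) * fps_nth F (k + 2)
      = (real n + real k + 1) * (real n + real k + 2) * fps_nth F k" for k
    using arg_cong[OF ode, of "\<lambda>F. fps_nth F (k + 2)"]
    unfolding g_def fps_add_nth x2_def fps_nth_mult_X2 fps_X_deriv_nth C_def fps_mult_left_const_nth Gk
    by (simp add: algebra_simps)
  moreover have "fps_nth F 0 = 1" "fps_nth F (Suc 0) = 0"
    using fps_nth_power_01[OF J01, of "Suc n"] unfolding F_def by auto
  ultimately show ?thesis
    unfolding J_def[symmetric] F_def[symmetric] by (intro gegenbauer_moment_of_coeff_recurrence) auto
qed

section \<open>The densities\<close>

text \<open>The constant is 1 / (4^v B(v + 1/2, v + 1/2)). By duplication it equals Gamma(v + 1) /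
  (sqrt pi Gamma(v + 1/2)), the constant of p_n after x = c s w; in this form v = 0 needs no special
  reading.\<close>

definition gegenbauer_density :: "real \<Rightarrow> real \<Rightarrow> real" where
  "gegenbauer_density v x =
    (if \<bar>x\<bar> < 1 then Gamma (2 * v + 1) / (4 powr v * (Gamma (v + 1/2))\<^sup>2) * (1 - x\<^sup>2) powr (v - 1/2)
     else 0)"

lemma gegenbauer_density_measurable [measurable]: "gegenbauer_density v \<in> borel_measurable borel"
  unfolding gegenbauer_density_def[abs_def] by measurable

lemma gegenbauer_density_nonneg: "0 \<le> v \<Longrightarrow> 0 \<le> gegenbauer_density v x"
  by (auto simp: gegenbauer_density_def intro!: mult_nonneg_nonneg divide_nonneg_nonneg less_imp_le[OF Gamma_real_pos])

lemma gegenbauer_density_minus [simp]: "gegenbauer_density v (- x) = gegenbauer_density v x"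
  by (simp add: gegenbauer_density_def)

lemma gegenbauer_density_nn_integral:
  assumes "0 \<le> v"
  shows "(\<integral>\<^sup>+ x. ennreal (gegenbauer_density v x) \<partial>lborel) = 1"
proof -
  define f where "f t = (t powr (v - 1/2) * (1 - t) powr (v - 1/2)) * indicator {0..1} t" for t :: real
  define B where "B = Beta (v + 1/2) (v + 1/2)"
  define K where "K = Gamma (2 * v + 1) / (4 powr v * (Gamma (v + 1/2))\<^sup>2)"
  have K: "K = 1 / (4 powr v * B)"
    by (simp add: K_def B_def Beta_def power2_eq_square)
  have Bpos: "B > 0"
    unfolding B_def Beta_def using assms by (intro divide_pos_pos mult_pos_pos Gamma_real_pos) auto
  have [measurable]: "f \<in> borel_measurable borel" unfolding f_def by measurable
  have "((\<lambda>t. t powr (v - 1/2) * (1 - t) powr (v - 1/2)) has_integral B) {0..1}"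
    using has_integral_Beta_real[of "v + 1/2" "v + 1/2"] assms by (simp add: B_def)
  from nn_integral_has_integral_lebesgue[OF _ this]
  have "ennreal B = (\<integral>\<^sup>+ t. ennreal (f t) \<partial>lborel)"
    by (simp add: f_def nn_integral_completion mult.commute)
  \<comment> \<open>With t = (1 + x)/2 the product t (1 - t) is (1 - x^2)/4. Its power v - 1/2
    contributes 2 / 4^v, and the 2 cancels the Jacobian 1/2.\<close>
  also have "\<dots> = ennreal (1/2) * (\<integral>\<^sup>+ x. ennreal (f (1/2 + 1/2 * x)) \<partial>lborel)"
    by (subst nn_integral_real_affine[of _ "1/2" "1/2"]) auto
  also have "\<dots> = (\<integral>\<^sup>+ x. ennreal (B * gegenbauer_density v x) \<partial>lborel)"
  proof (subst nn_integral_cmult[symmetric], measurable, intro nn_integral_cong)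
    fix x :: real
    have "1/2 * f (1/2 + 1/2 * x) = B * gegenbauer_density v x"
    proof (cases "\<bar>x\<bar> < 1")
      case True
      then have "1 - x\<^sup>2 > 0" by (simp add: abs_square_less_1)
      have "f (1/2 + 1/2 * x) = ((1/2 + 1/2 * x) * (1/2 - 1/2 * x)) powr (v - 1/2)"
      proof -
        have "1/2 + 1/2 * x \<in> {0..1}" using True by (simp add: abs_less_iff)
        moreover have "1 - (1/2 + 1/2 * x) = 1/2 - 1/2 * x" by simp
        ultimately show ?thesis
          unfolding f_def by (metis (no_types) indicator_simps(1) mult.right_neutral powr_mult)
      qed
      also have "(1/2 + 1/2 * x) * (1/2 - 1/2 * x) = (1 - x\<^sup>2) / 4"
        by (simp add: power2_eq_square field_simps)
      also have "((1 - x\<^sup>2) / 4) powr (v - 1/2) = (1 - x\<^sup>2) powr (v - 1/2) / (4 powr v / 4 powr (1/2))"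
        using \<open>1 - x\<^sup>2 > 0\<close> by (simp add: powr_divide powr_diff)
      finally show ?thesis
        using True Bpos by (simp add: gegenbauer_density_def K_def[symmetric] K powr_half_sqrt)
    next
      case False
      then have "f (1/2 + 1/2 * x) = 0"
        by (auto simp: f_def indicator_def field_simps abs_if split: if_splits)
      then show ?thesis using False by (simp add: gegenbauer_density_def)
    qed
    then show "ennreal (1/2) * ennreal (f (1/2 + 1/2 * x)) = ennreal (B * gegenbauer_density v x)"
      using Bpos gegenbauer_density_nonneg[OF assms, of x]
      by (subst ennreal_mult[symmetric]) (auto simp: f_def)
  qed
  also have "\<dots> = ennreal B * (\<integral>\<^sup>+ x. ennreal (gegenbauer_density v x) \<partial>lborel)"
    using Bpos gegenbauer_density_nonneg[OF assms]
    by (subst nn_integral_cmult[symmetric]) (auto simp: ennreal_mult)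
  finally have "ennreal B * (\<integral>\<^sup>+ x. ennreal (gegenbauer_density v x) \<partial>lborel) = ennreal B * 1"
    by simp
  then show ?thesis
    using Bpos by (subst (asm) ennreal_mult_cancel_left) auto
qed

lemma gegenbauer_density_moment:
  assumes "0 \<le> v"
  shows "integrable lborel (\<lambda>x. gegenbauer_density v x * x ^ k)" (is "?int k")
    and "(\<integral>x. gegenbauer_density v x * x ^ k \<partial>lborel) = gegenbauer_moment v k"
proof -
  let ?g = "gegenbauer_density v"
  have intg: "integrable lborel ?g"
    using gegenbauer_density_nn_integral[OF assms] gegenbauer_density_nonneg[OF assms]
    by (intro integrableI_nonneg) auto
  show int: "?int k" for k
  proof (rule Bochner_Integration.integrable_bound[OF intg])
    show "AE x in lborel. norm (?g x * x ^ k) \<le> norm (?g x)"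
    proof (rule AE_I2)
      fix x show "norm (?g x * x ^ k) \<le> norm (?g x)"
      proof (cases "\<bar>x\<bar> < 1")
        case True
        then have "\<bar>?g x\<bar> * \<bar>x\<bar> ^ k \<le> \<bar>?g x\<bar>"
          by (intro mult_right_le_one_le power_le_one) auto
        then show ?thesis by (simp add: abs_mult power_abs)
      qed (simp add: gegenbauer_density_def)
    qed
  qed measurable
  define I where "I k = (\<integral>x. ?g x * x ^ k \<partial>lborel)" for k
  define K where "K = Gamma (2 * v + 1) / (4 powr v * (Gamma (v + 1/2))\<^sup>2)"
  have "I k = gegenbauer_moment v k" for k
  proof (rule gegenbauer_momentI[OF assms])
    have "ennreal (I 0) = 1"
      unfolding I_def using gegenbauer_density_nn_integral[OF assms] gegenbauer_density_nonneg[OF assms] intg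
      by (subst nn_integral_eq_integral[symmetric]) auto
    then show "I 0 = 1" by simp
    have "I (Suc 0) = (\<integral>x. ?g (0 + (-1) * x) * (0 + (-1) * x) ^ Suc 0 \<partial>lborel)"
      unfolding I_def by (subst lborel_integral_real_affine[of "-1" _ 0]) auto
    then show "I (Suc 0) = 0" by (simp add: I_def)
    fix k
    \<comment> \<open>The exponent v + 1/2 is positive, so F is continuous on the closed interval
      and vanishes at both ends. Its derivative f may blow up there when v < 1/2, hence the interior
      form of the fundamental theorem.\<close>
    define F where "F x = K * (x ^ Suc k * (1 - x\<^sup>2) powr (v + 1/2))" for x :: real
    define f where "f x = (real k + 1) * (?g x * x ^ k) - (real k + 2 * v + 2) * (?g x * x ^ Suc (Suc k))" for x
    have "(f has_integral (F 1 - F (-1))) {-1..1}"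
    proof (rule fundamental_theorem_of_calculus_interior)
      show "continuous_on {-1..1} F" unfolding F_def
      proof (intro continuous_on_mult continuous_on_powr' continuous_intros ballI conjI impI)
        fix x :: real assume "x \<in> {-1..1}"
        then show "0 \<le> 1 - x\<^sup>2" by (simp add: abs_square_le_1 abs_le_iff)
      qed (use assms in auto)
      fix x :: real assume x: "x \<in> {-1<..<1}"
      then have pos: "1 - x\<^sup>2 > 0" by (simp add: abs_square_less_1 abs_less_iff)
      have "(F has_real_derivative K * ((real k + 1) * x ^ k * (1 - x\<^sup>2) powr (v + 1/2)
          + x ^ Suc k * ((v + 1/2) * (1 - x\<^sup>2) powr (v + 1/2 - 1) * (- 2 * x)))) (at x)"
        unfolding F_def using pos
        by (auto intro!: derivative_eq_intros simp del: power_Suc)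
      also have "(1 - x\<^sup>2) powr (v + 1/2) = (1 - x\<^sup>2) * (1 - x\<^sup>2) powr (v - 1/2)"
        using pos powr_add[of "1 - x\<^sup>2" 1 "v - 1/2"] by (simp add: add.commute)
      also have "v + 1/2 - 1 = v - 1/2" by simp
      also have "K * ((real k + 1) * x ^ k * ((1 - x\<^sup>2) * (1 - x\<^sup>2) powr (v - 1/2))
          + x ^ Suc k * ((v + 1/2) * (1 - x\<^sup>2) powr (v - 1/2) * (- 2 * x))) = f x"
      proof -
        define P where "P = (1 - x\<^sup>2) powr (v - 1/2)"
        have g: "?g x = K * P"
          using x by (simp add: P_def gegenbauer_density_def K_def abs_less_iff)
        show ?thesis
          unfolding P_def[symmetric] f_def g power_Suc by (simp add: algebra_simps power2_eq_square)
      qed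
      finally show "(F has_vector_derivative f x) (at x)"
        by (simp add: has_real_derivative_iff_has_vector_derivative)
    qed simp
    then have "((\<lambda>x. if x \<in> {-1..1} then f x else 0) has_integral 0) UNIV"
      unfolding has_integral_restrict_UNIV by (simp add: F_def)
    also have "(\<lambda>x. if x \<in> {-1..1} then f x else 0) = f"
      by (auto simp: f_def gegenbauer_density_def abs_less_iff)
    finally have 1: "(f has_integral 0) UNIV" .
    have "(f has_integral (\<integral>x. f x \<partial>lborel)) UNIV"
      unfolding f_def by (intro has_integral_integral_lborel Bochner_Integration.integrable_diff integrable_mult_right int)
    with 1 have "(\<integral>x. f x \<partial>lborel) = 0" using has_integral_unique by blast
    then show "(real k + 2 * v + 2) * I (Suc (Suc k)) = (real k + 1) * I k"
      unfolding f_def by (subst (asm) Bochner_Integration.integral_diff) (auto simp: I_def intro!: integrable_mult_right int simp del: power_Suc)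
  qed
  then show "(\<integral>x. ?g x * x ^ k \<partial>lborel) = gegenbauer_moment v k" by (simp add: I_def)
qed

definition gegenbauer_law :: "real \<Rightarrow> real measure" where
  "gegenbauer_law v = density lborel (gegenbauer_density v)"

text \<open>Integrating the derivative of cos^(k+1) sin^(2m+1) over the angle gives the recurrence
  with v = m, the boundary terms vanishing with sin. The initial value 1 is the total mass, so the
  constant K is never evaluated.\<close>

lemma angle_moment:
  assumes "prob_space M" "distributed M lborel X (angle_density m)"
  shows "(\<integral>\<omega>. cos (X \<omega>) ^ k \<partial>M) = gegenbauer_moment (real m) k"
proof -
  interpret prob_space M by fact
  define K where "K = Gamma (real m + 1) / (sqrt pi * Gamma (real m + 1/2))"
  have Kpos: "K \<ge> 0" unfolding K_def
    by (intro divide_nonneg_nonneg mult_nonneg_nonneg less_imp_le[OF Gamma_real_pos]) auto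
  have dens: "angle_density m x = K * (sin x ^ (2 * m)) * indicator {0<..<pi} x" for x
    by (auto simp: angle_density_def K_def)
  have nn: "angle_density m x \<ge> 0" for x
    using Kpos by (auto simp: dens power_mult intro!: mult_nonneg_nonneg)
  have X [measurable]: "random_variable borel X" using distributed_measurable[OF assms(2)] by simp
  define I where "I k = (\<integral>\<omega>. cos (X \<omega>) ^ k \<partial>M)" for k
  have intX: "integrable M (\<lambda>\<omega>. cos (X \<omega>) ^ k)" for k
    by (rule integrable_const_bound[of _ 1]) (auto simp: power_abs power_le_one)
  have I: "(\<lambda>x. angle_density m x * cos x ^ k) = (\<lambda>x. K * sin x ^ (2 * m) * cos x ^ k * indicator {0<..<pi} x)" for k
    by (auto simp: dens)
  have hasI: "((\<lambda>x. K * sin x ^ (2 * m) * cos x ^ k) has_integral I k) {0..pi}" for k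
  proof -
    have int: "integrable lborel (\<lambda>x. angle_density m x * cos x ^ k)"
      using intX[of k] distributed_integrable[OF assms(2), of "\<lambda>x. cos x ^ k"] nn by auto
    have "(\<integral>x. angle_density m x * cos x ^ k \<partial>lborel) = I k"
      unfolding I_def by (rule distributed_integral[OF assms(2)]) (auto simp: nn)
    with has_integral_integral_lborel[OF int]
    have "((\<lambda>x. angle_density m x * cos x ^ k) has_integral I k) UNIV" by simp
    moreover have "(\<lambda>x. angle_density m x * cos x ^ k)
        = (\<lambda>x. if x \<in> {0<..<pi} then K * sin x ^ (2 * m) * cos x ^ k else 0)"
      by (auto simp: dens)
    ultimately have "((\<lambda>x. if x \<in> {0<..<pi} then K * sin x ^ (2 * m) * cos x ^ k else 0) has_integral I k) UNIV"
      by simp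
    then have "((\<lambda>x. K * sin x ^ (2 * m) * cos x ^ k) has_integral I k) {0<..<pi}"
      by (simp only: has_integral_restrict_UNIV)
    then show ?thesis by (simp add: has_integral_Icc_iff_Ioo)
  qed
  have "I k = gegenbauer_moment (real m) k"
  proof (rule gegenbauer_momentI)
    show "I 0 = 1" by (simp add: I_def prob_space)
    have int1: "((\<lambda>x. K * sin x ^ (2 * m) * cos x) has_integral
        K * (sin pi ^ Suc (2 * m) / real (Suc (2 * m))) - K * (sin 0 ^ Suc (2 * m) / real (Suc (2 * m)))) {0..pi}"
    proof (rule fundamental_theorem_of_calculus)
      fix x
      have "((\<lambda>x. K * (sin x ^ Suc (2 * m) / real (Suc (2 * m)))) has_real_derivative
        K * (real (Suc (2 * m)) * sin x ^ (2 * m) * cos x / real (Suc (2 * m)))) (at x within {0..pi})"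
        by (auto intro!: derivative_eq_intros simp del: power_Suc of_nat_Suc)
      then show "((\<lambda>x. K * (sin x ^ Suc (2 * m) / real (Suc (2 * m)))) has_vector_derivative
        K * sin x ^ (2 * m) * cos x) (at x within {0..pi})"
        unfolding has_real_derivative_iff_has_vector_derivative[symmetric]
        by (rule DERIV_cong) simp
    qed simp
    then show "I (Suc 0) = 0"
      using has_integral_unique[OF hasI[of 1, unfolded power_one_right] int1] by simp
    fix k
    have "((\<lambda>x. (real k + 2 * real m + 2) * (K * sin x ^ (2 * m) * cos x ^ Suc (Suc k))
           - (real k + 1) * (K * sin x ^ (2 * m) * cos x ^ k)) has_integral
        K * (cos pi ^ Suc k * sin pi ^ Suc (2 * m)) - K * (cos 0 ^ Suc k * sin 0 ^ Suc (2 * m))) {0..pi}"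
    proof (rule fundamental_theorem_of_calculus)
      fix x
      have "((\<lambda>x. K * (cos x ^ Suc k * sin x ^ Suc (2 * m))) has_real_derivative
        K * (cos x ^ Suc k * ((2 * real m + 1) * sin x ^ (2 * m) * cos x)
          - (real k + 1) * cos x ^ k * sin x * sin x ^ Suc (2 * m))) (at x within {0..pi})"
        by (auto intro!: derivative_eq_intros simp del: power_Suc) (simp add: algebra_simps)
      also have "(real k + 1) * cos x ^ k * sin x * sin x ^ Suc (2 * m)
          = (real k + 1) * cos x ^ k * sin x ^ (2 * m) * (sin x)\<^sup>2"
        by (simp add: power2_eq_square)
      also have "(sin x)\<^sup>2 = 1 - (cos x)\<^sup>2" by (rule sin_squared_eq)
      finally show "((\<lambda>x. K * (cos x ^ Suc k * sin x ^ Suc (2 * m))) has_vector_derivative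
         (real k + 2 * real m + 2) * (K * sin x ^ (2 * m) * cos x ^ Suc (Suc k))
           - (real k + 1) * (K * sin x ^ (2 * m) * cos x ^ k)) (at x within {0..pi})"
        unfolding has_real_derivative_iff_has_vector_derivative[symmetric]
        by (rule DERIV_cong) (simp add: algebra_simps power2_eq_square)
    qed simp
    moreover have "((\<lambda>x. (real k + 2 * real m + 2) * (K * sin x ^ (2 * m) * cos x ^ Suc (Suc k))
           - (real k + 1) * (K * sin x ^ (2 * m) * cos x ^ k)) has_integral
        (real k + 2 * real m + 2) * I (Suc (Suc k)) - (real k + 1) * I k) {0..pi}"
      by (intro has_integral_diff has_integral_mult_right hasI)
    ultimately have "(real k + 2 * real m + 2) * I (Suc (Suc k)) - (real k + 1) * I k
        = K * (cos pi ^ Suc k * sin pi ^ Suc (2 * m)) - K * (cos 0 ^ Suc k * sin 0 ^ Suc (2 * m))"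
      by (rule has_integral_unique[rotated])
    then show "(real k + 2 * real m + 2) * I (Suc (Suc k)) = (real k + 1) * I k" by simp
  qed simp
  then show ?thesis by (simp add: I_def)
qed

section \<open>Moments of the random flight\<close>

text \<open>A finite set of indices splits into a left and a right part; independence of the two
  families separates these, independence within each does the rest. Angles and waiting times can
  then be treated as one family, from which disjoint groups are selected.\<close>

lemma (in prob_space) indep_vars_case_sum:
  fixes X Y :: "'i \<Rightarrow> 'a \<Rightarrow> real"
  assumes X: "indep_vars (\<lambda>_. borel) X UNIV" and Y: "indep_vars (\<lambda>_. borel) Y UNIV"
    and XY: "indep_var (Pi\<^sub>M UNIV (\<lambda>_. borel)) (\<lambda>\<omega> i. X i \<omega>) (Pi\<^sub>M UNIV (\<lambda>_. borel)) (\<lambda>\<omega> j. Y j \<omega>)"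
  shows "indep_vars (\<lambda>_. borel) (case_sum X Y) UNIV"
proof -
  have rvX [measurable]: "random_variable borel (X i)" for i
    using X by (auto simp: indep_vars_def2)
  have rvY [measurable]: "random_variable borel (Y j)" for j
    using Y by (auto simp: indep_vars_def2)
  have prod: "prob {\<omega>\<in>space M. \<forall>k\<in>K. Z k \<omega> \<in> A k} = (\<Prod>k\<in>K. prob (Z k -` A k \<inter> space M))"
    if "indep_vars (\<lambda>_. borel) Z UNIV" "finite K" "\<And>k. k \<in> K \<Longrightarrow> A k \<in> sets borel"
    for Z :: "'k \<Rightarrow> 'a \<Rightarrow> real" and K A
  proof (cases "K = {}")
    case False
    have "{\<omega>\<in>space M. \<forall>k\<in>K. Z k \<omega> \<in> A k} = (\<Inter>k\<in>K. Z k -` A k \<inter> space M)"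
      using False by auto
    then show ?thesis using indep_varsD[OF that(1) False that(2)] that(3) by simp
  qed (simp add: prob_space)
  show ?thesis
    unfolding indep_vars_def2 indep_sets_def
  proof (intro conjI ballI allI impI)
    fix i show "random_variable borel (case_sum X Y i)" by (cases i) auto
    then show "{case_sum X Y i -` A \<inter> space M |A. A \<in> sets borel} \<subseteq> events"
      by auto
  next
    fix J and C
    assume J: "finite J" and C: "C \<in> Pi J (\<lambda>i. {case_sum X Y i -` A \<inter> space M |A. A \<in> sets borel})"
      and "J \<noteq> {}"
    from C obtain A where A: "\<And>i. i \<in> J \<Longrightarrow> C i = case_sum X Y i -` A i \<inter> space M \<and> A i \<in> sets borel"
      unfolding Pi_iff mem_Collect_eq by metis
    define K where "K = Inl -` J"
    define L where "L = Inr -` J"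
    have fin: "finite K" "finite L" using J by (auto simp: K_def L_def intro!: finite_vimageI)
    have JKL: "J = Inl ` K \<union> Inr ` L"
    proof (intro equalityI subsetI)
      show "x \<in> Inl ` K \<union> Inr ` L" if "x \<in> J" for x
        using that by (cases x) (auto simp: K_def L_def)
    qed (auto simp: K_def L_def)
    let ?P = "{f \<in> space (Pi\<^sub>M UNIV (\<lambda>_. borel)). \<forall>k\<in>K. f k \<in> A (Inl k)}"
    let ?Q = "{f \<in> space (Pi\<^sub>M UNIV (\<lambda>_. borel)). \<forall>l\<in>L. f l \<in> A (Inr l)}"
    have meas: "?P \<in> sets (Pi\<^sub>M UNIV (\<lambda>_. borel))" "?Q \<in> sets (Pi\<^sub>M UNIV (\<lambda>_. borel))"
    proof -
      have single: "{f \<in> space (Pi\<^sub>M UNIV (\<lambda>_. borel)). f k \<in> B} \<in> sets (Pi\<^sub>M UNIV (\<lambda>_. borel))"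
        if [measurable]: "B \<in> sets borel" for k :: 'i and B :: "real set"
        by measurable
      show "?P \<in> sets (Pi\<^sub>M UNIV (\<lambda>_. borel))"
        by (rule sets.sets_Collect_finite_All[OF _ fin(1)], rule single) (use A in \<open>simp add: K_def\<close>)
      show "?Q \<in> sets (Pi\<^sub>M UNIV (\<lambda>_. borel))"
        by (rule sets.sets_Collect_finite_All[OF _ fin(2)], rule single) (use A in \<open>simp add: L_def\<close>)
    qed
    have "(\<Inter>i\<in>J. C i) = (\<lambda>\<omega>. (\<lambda>i. X i \<omega>, \<lambda>j. Y j \<omega>)) -` (?P \<times> ?Q) \<inter> space M"
    proof -
      have "C (Inl k) = X k -` A (Inl k) \<inter> space M" if "k \<in> K" for k
        using A that by (simp add: K_def)
      moreover have "C (Inr l) = Y l -` A (Inr l) \<inter> space M" if "l \<in> L" for l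
        using A that by (simp add: L_def)
      moreover have "(\<Inter>i\<in>J. C i) = (\<Inter>k\<in>K. C (Inl k)) \<inter> (\<Inter>l\<in>L. C (Inr l))"
        unfolding JKL by auto
      \<comment> \<open>One of the two intersections may run over no index and be all of the type;
        the other then confines the whole to \<open>space M\<close>.\<close>
      moreover have "K \<noteq> {} \<or> L \<noteq> {}" using \<open>J \<noteq> {}\<close> unfolding JKL by auto
      ultimately show ?thesis by (auto simp: space_PiM)
    qed
    then have "prob (\<Inter>i\<in>J. C i) = prob ((\<lambda>\<omega> i. X i \<omega>) -` ?P \<inter> space M) * prob ((\<lambda>\<omega> j. Y j \<omega>) -` ?Q \<inter> space M)"
      using indep_varD[OF XY meas] by simp
    also have "(\<lambda>\<omega> i. X i \<omega>) -` ?P \<inter> space M = {\<omega>\<in>space M. \<forall>k\<in>K. X k \<omega> \<in> A (Inl k)}"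
      by (auto simp: space_PiM)
    also have "(\<lambda>\<omega> j. Y j \<omega>) -` ?Q \<inter> space M = {\<omega>\<in>space M. \<forall>l\<in>L. Y l \<omega> \<in> A (Inr l)}"
      by (auto simp: space_PiM)
    also have "prob {\<omega>\<in>space M. \<forall>k\<in>K. X k \<omega> \<in> A (Inl k)} = (\<Prod>k\<in>K. prob (C (Inl k)))"
      by (subst prod[OF X fin(1)]) (use A in \<open>auto simp: K_def intro!: prod.cong\<close>)
    also have "prob {\<omega>\<in>space M. \<forall>l\<in>L. Y l \<omega> \<in> A (Inr l)} = (\<Prod>l\<in>L. prob (C (Inr l)))"
      by (subst prod[OF Y fin(2)]) (use A in \<open>auto simp: L_def intro!: prod.cong\<close>)
    also have "(\<Prod>k\<in>K. prob (C (Inl k))) * (\<Prod>l\<in>L. prob (C (Inr l))) = (\<Prod>i\<in>J. prob (C i))"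
      unfolding JKL using fin by (subst prod.union_disjoint) (auto simp: prod.reindex)
    finally show "prob (\<Inter>i\<in>J. C i) = (\<Prod>i\<in>J. prob (C i))" .
  qed
qed

lemma (in prob_space) indep_vars_reindex:
  assumes "indep_vars M' X I" "inj_on f J" "f ` J \<subseteq> I"
  shows "indep_vars (\<lambda>j. M' (f j)) (\<lambda>j. X (f j)) J"
  unfolding indep_vars_def2 indep_sets_def
proof (intro conjI ballI allI impI)
  have I: "\<And>i. i \<in> I \<Longrightarrow> random_variable (M' i) (X i)" using assms(1) by (auto simp: indep_vars_def2)
  fix j assume "j \<in> J"
  then show "random_variable (M' (f j)) (X (f j))" using I assms(3) by auto
  then show "{X (f j) -` A \<inter> space M |A. A \<in> sets (M' (f j))} \<subseteq> events"
    by (auto intro: measurable_sets)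
next
  fix K C assume K: "K \<subseteq> J" "K \<noteq> {}" "finite K"
    and C: "C \<in> Pi K (\<lambda>j. {X (f j) -` A \<inter> space M |A. A \<in> sets (M' (f j))})"
  have inj: "inj_on f K" using assms(2) K(1) by (rule inj_on_subset)
  from C obtain A where A: "\<And>j. j \<in> K \<Longrightarrow> C j = X (f j) -` A j \<inter> space M \<and> A j \<in> sets (M' (f j))"
    unfolding Pi_iff mem_Collect_eq by metis
  define B where "B i = A (the_inv_into K f i)" for i
  have B: "B (f j) = A j" if "j \<in> K" for j
    using that inj by (simp add: B_def the_inv_into_f_f)
  have "prob (\<Inter>i\<in>f ` K. X i -` B i \<inter> space M) = (\<Prod>i\<in>f ` K. prob (X i -` B i \<inter> space M))"
    using K assms(3) A B by (intro indep_varsD[OF assms(1)]) auto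
  moreover have C': "C j = X (f j) -` B (f j) \<inter> space M" if "j \<in> K" for j
    using A B that by simp
  moreover have "(\<Inter>j\<in>K. C j) = (\<Inter>i\<in>f ` K. X i -` B i \<inter> space M)"
    using C' by auto
  ultimately show "prob (\<Inter>j\<in>K. C j) = (\<Prod>j\<in>K. prob (C j))"
    by (simp only: prod.reindex[OF inj] o_def cong: prod.cong)
qed

text \<open>A Beta integral at integer arguments. Integration by parts trades one power of x for one
  of r - x, with no boundary terms as both exponents are positive, until j = 0.\<close>

lemma power_convolution_has_integral:
  fixes r :: real
  assumes "0 \<le> r"
  shows "((\<lambda>x. x ^ j / fact j * ((r - x) ^ i / fact i)) has_integral r ^ (i + j + 1) / fact (i + j + 1)) {0..r}"
proof (induction j arbitrary: i)
  case 0
  have "((\<lambda>x. (r - x) ^ i / fact i) has_integral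
      - ((r - r) ^ Suc i / fact (Suc i)) - (- ((r - 0) ^ Suc i / fact (Suc i)))) {0..r}"
  proof (rule fundamental_theorem_of_calculus[OF assms])
    fix x
    have "((\<lambda>x. - ((r - x) ^ Suc i / fact (Suc i))) has_real_derivative
        (real (Suc i) * (r - x) ^ i / fact (Suc i))) (at x within {0..r})"
      by (auto intro!: derivative_eq_intros simp del: power_Suc fact_Suc of_nat_Suc)
    also have "real (Suc i) * (r - x) ^ i / fact (Suc i) = (r - x) ^ i / fact i"
      by (simp del: of_nat_Suc)
    finally show "((\<lambda>x. - ((r - x) ^ Suc i / fact (Suc i))) has_vector_derivative (r - x) ^ i / fact i)
        (at x within {0..r})"
      by (simp add: has_real_derivative_iff_has_vector_derivative)
  qed
  then show ?case by simp
next
  case (Suc j)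
  let ?f = "\<lambda>j i x. x ^ j / fact j * ((r - x) ^ i / fact i) :: real"
  have "((\<lambda>x. ?f j (Suc i) x - ?f (Suc j) i x) has_integral
      ?f (Suc j) (Suc i) r - ?f (Suc j) (Suc i) 0) {0..r}"
  proof (rule fundamental_theorem_of_calculus[OF assms])
    fix x
    have d1: "((\<lambda>x. (r - x) ^ Suc i / fact (Suc i)) has_real_derivative
        - (real (Suc i) * (r - x) ^ i / fact (Suc i))) (at x within {0..r})"
      by (auto intro!: derivative_eq_intros simp del: power_Suc fact_Suc of_nat_Suc)
    have d2: "((\<lambda>x. x ^ Suc j / fact (Suc j)) has_real_derivative
        (real (Suc j) * x ^ j / fact (Suc j))) (at x within {0..r})"
      by (auto intro!: derivative_eq_intros simp del: power_Suc fact_Suc of_nat_Suc)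
    have e: "real (Suc i) * (r - x) ^ i / fact (Suc i) = (r - x) ^ i / fact i"
      "real (Suc j) * x ^ j / fact (Suc j) = x ^ j / fact j"
      by (simp_all del: of_nat_Suc)
    show "(?f (Suc j) (Suc i) has_vector_derivative ?f j (Suc i) x - ?f (Suc j) i x) (at x within {0..r})"
      unfolding has_real_derivative_iff_has_vector_derivative[symmetric]
      by (rule DERIV_cong[OF DERIV_mult[OF d2[unfolded e] d1[unfolded e]]]) (simp add: mult_ac del: power_Suc fact_Suc)
  qed
  then have "((\<lambda>x. ?f j (Suc i) x - ?f (Suc j) i x) has_integral 0) {0..r}" by simp
  from has_integral_diff[OF Suc.IH[of "Suc i"] this]
  show ?case by simp
qed

text \<open>This family is closed under convolution with the exponential law; the weight \<open>exp (lam u)\<close> makes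
  the factors \<open>exp (- lam x)\<close> of the waiting times disappear.\<close>

definition tilted_power :: "real \<Rightarrow> real \<Rightarrow> nat \<Rightarrow> real \<Rightarrow> real" where
  "tilted_power lam s i u = (s - u) ^ i / fact i * exp (lam * u) * indicator {..s} u"

lemma tilted_power_measurable [measurable]: "tilted_power lam s i \<in> borel_measurable borel"
  unfolding tilted_power_def[abs_def] by measurable

text \<open>Up to a factor independent of u, \<open>tilted_power lam s i u\<close> is the Poisson
  probability of i events during s - u. The factor \<open>x ^ j\<close> is the leg length to the
  power with which its cosine occurs, so integrating out a leg raises the index by j + 1.\<close>

lemma tilted_power_convolution:
  assumes "0 < lam"
  shows "(\<integral>x. exponential_density lam x * (x ^ j * tilted_power lam s i (u + x)) \<partial>lborel)
    = lam * fact j * tilted_power lam s (i + j + 1) u"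
proof (cases "u \<le> s")
  case True
  define r where "r = s - u"
  have r: "0 \<le> r" using True by (simp add: r_def)
  let ?f = "\<lambda>x. x ^ j / fact j * ((r - x) ^ i / fact i) :: real"
  have "exponential_density lam x * (x ^ j * tilted_power lam s i (u + x))
      = lam * fact j * exp (lam * u) * (indicator {0..r} x *\<^sub>R ?f x)" for x
    by (auto simp: exponential_density_def tilted_power_def indicator_def r_def exp_add[symmetric] algebra_simps
         simp flip: exp_add)
  then have "(\<integral>x. exponential_density lam x * (x ^ j * tilted_power lam s i (u + x)) \<partial>lborel)
      = lam * fact j * exp (lam * u) * (LINT x:{0..r}|lborel. ?f x)"
    by (simp add: set_lebesgue_integral_def)
  also have "(LINT x:{0..r}|lborel. ?f x) = integral {0..r} ?f"
    by (intro set_borel_integral_eq_integral borel_integrable_atLeastAtMost' continuous_intros) auto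
  also have "\<dots> = r ^ (i + j + 1) / fact (i + j + 1)"
    using power_convolution_has_integral[OF r] by (rule integral_unique)
  finally show ?thesis using True by (simp add: tilted_power_def r_def)
next
  case False
  then have *: "exponential_density lam x * (x ^ j * tilted_power lam s i (u + x)) = 0" for x
    by (auto simp: exponential_density_def tilted_power_def)
  show ?thesis unfolding * using False by (simp add: tilted_power_def)
qed

lemma exponential_density_tail_integral:
  assumes "0 < lam" "0 \<le> r"
  shows "(\<integral>x. exponential_density lam x * indicator {r<..} x \<partial>lborel) = exp (- lam * r)"
proof -
  interpret E: prob_space "density lborel (exponential_density lam)"
    by (rule prob_space_exponential_density) fact
  have "distributed (density lborel (exponential_density lam)) lborel (\<lambda>x. x) (exponential_density lam)"
    by (auto simp: distributed_def distr_id2)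
  then have "measure (density lborel (exponential_density lam)) {r<..} = exp (- lam * r)"
    using E.exponential_distributedD_gt[of "\<lambda>x. x" lam r] assms
    by (simp add: greaterThan_def mult.commute)
  also have "measure (density lborel (exponential_density lam)) {r<..}
      = (\<integral>x. indicator {r<..} x \<partial>density lborel (exponential_density lam))"
    by simp
  also have "\<dots> = (\<integral>x. exponential_density lam x *\<^sub>R indicator {r<..} x \<partial>lborel)"
    using assms by (intro integral_density) (auto simp: exponential_density_def)
  finally show ?thesis by (simp only: real_scaleR_def)
qed

text \<open>Fubini on the product of the two laws, pulled back to M. It freezes the past of the
  flight while the next leg is averaged.\<close>

lemma (in prob_space) indep_var_integral_iterated:
  fixes h :: "'b \<times> 'b \<Rightarrow> real"
  assumes "indep_var P X Q Y" and [measurable]: "h \<in> borel_measurable (P \<Otimes>\<^sub>M Q)"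
    and int: "integrable M (\<lambda>\<omega>. h (X \<omega>, Y \<omega>))"
  shows "(\<integral>\<omega>. h (X \<omega>, Y \<omega>) \<partial>M) = (\<integral>\<omega>. \<integral>\<omega>'. h (X \<omega>, Y \<omega>') \<partial>M \<partial>M)"
proof -
  have [measurable]: "random_variable P X" "random_variable Q Y"
    and pair: "distr M P X \<Otimes>\<^sub>M distr M Q Y = distr M (P \<Otimes>\<^sub>M Q) (\<lambda>\<omega>. (X \<omega>, Y \<omega>))"
    using assms(1) by (auto simp: indep_var_distribution_eq)
  interpret X: prob_space "distr M P X" by (rule prob_space_distr) measurable
  interpret Y: prob_space "distr M Q Y" by (rule prob_space_distr) measurable
  interpret XY: pair_sigma_finite "distr M P X" "distr M Q Y" ..
  have "(\<integral>\<omega>. h (X \<omega>, Y \<omega>) \<partial>M) = (\<integral>z. h z \<partial>(distr M P X \<Otimes>\<^sub>M distr M Q Y))"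
    unfolding pair by (subst integral_distr) auto
  also have "\<dots> = (\<integral>x. \<integral>y. h (x, y) \<partial>distr M Q Y \<partial>distr M P X)"
  proof (rule XY.integral_fst'[symmetric])
    show "integrable (distr M P X \<Otimes>\<^sub>M distr M Q Y) h"
      unfolding pair by (subst integrable_distr_eq) (auto intro: int)
  qed
  also have "\<dots> = (\<integral>x. \<integral>\<omega>'. h (x, Y \<omega>') \<partial>M \<partial>distr M P X)"
    by (intro Bochner_Integration.integral_cong refl) (subst integral_distr; simp)
  also have "\<dots> = (\<integral>\<omega>. \<integral>\<omega>'. h (X \<omega>, Y \<omega>') \<partial>M \<partial>M)"
    by (rule integral_distr) measurable
  finally show ?thesis .
qed

section \<open>Waiting times, event times and the event count\<close>

context random_flight
begin

definition wait :: "nat \<Rightarrow> 'a \<Rightarrow> real" where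
  "wait k \<omega> = S (Suc k) \<omega> - S k \<omega>"

text \<open>One independent family for all randomness of the flight. Angles are numbered from 1, so
  the shift pairs the k-th waiting time with the angle of the leg whose length it is.\<close>

definition source :: "nat + nat \<Rightarrow> 'a \<Rightarrow> real" where
  "source = case_sum (\<lambda>k. \<theta> (Suc k)) wait"

text \<open>Agrees with \<open>S n\<close> on the sample space, but is visibly a function of the
  independent family \<open>source\<close>.\<close>

definition elapsed :: "nat \<Rightarrow> 'a \<Rightarrow> real" where
  "elapsed n \<omega> = (\<Sum>k<n. wait k \<omega>)"

definition travelled :: "nat \<Rightarrow> 'a \<Rightarrow> real" where
  "travelled n \<omega> = (\<Sum>k<n. wait k \<omega> * cos (\<theta> (Suc k) \<omega>))"

lemma wait_measurable [measurable]: "random_variable borel (wait k)"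
  using waiting_indep by (simp add: indep_vars_def2 wait_def[abs_def])

lemma angle_measurable [measurable]: "random_variable borel (\<theta> (Suc k))"
  using angle_indep by (simp add: indep_vars_def2)

lemma elapsed_measurable [measurable]: "random_variable borel (elapsed n)"
  unfolding elapsed_def[abs_def] by measurable

lemma travelled_measurable [measurable]: "random_variable borel (travelled n)"
  unfolding travelled_def[abs_def] by measurable

lemma elapsed_eq_S: "\<omega> \<in> space M \<Longrightarrow> elapsed n \<omega> = S n \<omega>"
  unfolding elapsed_def wait_def by (subst sum_lessThan_telescope) (simp add: S_0)

lemma indep_source: "indep_vars (\<lambda>_. borel) source UNIV"
  unfolding source_def
proof (rule indep_vars_case_sum)
  show "indep_vars (\<lambda>_. borel) wait UNIV"
    using waiting_indep by (simp add: wait_def[abs_def])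
  show "indep_vars (\<lambda>_. borel) (\<lambda>k. \<theta> (Suc k)) UNIV"
    by (rule indep_vars_reindex[OF angle_indep, where f = Suc]) auto
  have "indep_var (Pi\<^sub>M UNIV (\<lambda>_. borel)) ((\<lambda>f k. f (Suc k)) \<circ> (\<lambda>\<omega>. \<lambda>j\<in>{1..}. \<theta> j \<omega>))
      (Pi\<^sub>M UNIV (\<lambda>_. borel)) ((\<lambda>f k. f (Suc k) - f k) \<circ> (\<lambda>\<omega> k. S k \<omega>))"
  proof (rule indep_var_compose[OF angle_event_indep])
    show "(\<lambda>f k. f (Suc k)) \<in> measurable (Pi\<^sub>M {1..} (\<lambda>_. borel :: real measure)) (Pi\<^sub>M UNIV (\<lambda>_. borel))"
      by (rule measurable_PiM_single') (auto simp: space_PiM)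
    show "(\<lambda>f k. f (Suc k) - f k) \<in> measurable (Pi\<^sub>M UNIV (\<lambda>_. borel :: real measure)) (Pi\<^sub>M UNIV (\<lambda>_. borel))"
      by (rule measurable_PiM_single') (auto simp: space_PiM)
  qed
  then have "indep_var (Pi\<^sub>M UNIV (\<lambda>_. borel)) (\<lambda>\<omega> k. \<theta> (Suc k) \<omega>) (Pi\<^sub>M UNIV (\<lambda>_. borel)) (\<lambda>\<omega> k. wait k \<omega>)"
    by (simp add: o_def wait_def)
  then show "indep_var (Pi\<^sub>M UNIV (\<lambda>_. borel)) (\<lambda>\<omega> i. \<theta> (Suc i) \<omega>) (Pi\<^sub>M UNIV (\<lambda>_. borel)) (\<lambda>\<omega> j. wait j \<omega>)" .
qed

lemma wait_distr: "distributed M lborel (wait k) (exponential_density lam)"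
  using waiting_distr by (simp add: wait_def[abs_def])

lemma AE_wait_pos: "AE \<omega> in M. \<forall>k. 0 < wait k \<omega>"
proof (subst AE_all_countable, rule allI)
  fix k
  have "\<P>(\<omega> in M. 0 < wait k \<omega>) = 1"
    using exponential_distributedD_gt[OF wait_distr _ rate_pos, of 0] by simp
  then show "AE \<omega> in M. 0 < wait k \<omega>"
    by (subst (asm) prob_Collect_eq_1) auto
qed

text \<open>The first n waiting times are all at most s with probability (1 - exp(- s lam))^n, which
  tends to 0. One wait longer than s already rules out infinitely many events up to time s.\<close>

lemma AE_wait_exceeds:
  assumes "0 \<le> s" shows "AE \<omega> in M. \<exists>k. s < wait k \<omega>"
proof -
  let ?N = "{\<omega>\<in>space M. \<forall>k. wait k \<omega> \<le> s}"
  have le: "prob ?N \<le> (1 - exp (- s * lam)) ^ n" for n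
  proof (cases "n = 0")
    case False
    have iw: "indep_vars (\<lambda>_. borel) wait UNIV"
      using waiting_indep by (simp add: wait_def[abs_def])
    have "prob ?N \<le> prob (\<Inter>k<n. wait k -` {..s} \<inter> space M)"
      using False by (intro finite_measure_mono) auto
    also have "\<dots> = (\<Prod>k<n. prob (wait k -` {..s} \<inter> space M))"
      using False by (intro indep_varsD[OF iw]) auto
    also have "\<dots> = (\<Prod>k<n. 1 - exp (- s * lam))"
    proof (rule prod.cong[OF refl])
      fix k
      have "wait k -` {..s} \<inter> space M = {\<omega>\<in>space M. wait k \<omega> \<le> s}" by auto
      then show "prob (wait k -` {..s} \<inter> space M) = 1 - exp (- s * lam)"
        using exponential_distributedD_le[OF wait_distr assms rate_pos, of k] by simp
    qed
    finally show ?thesis by simp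
  qed simp
  have "(\<lambda>n. (1 - exp (- s * lam)) ^ n) \<longlonglongrightarrow> 0"
    using assms rate_pos by (intro LIMSEQ_power_zero) auto
  then have "prob ?N \<le> 0"
    by (rule LIMSEQ_le_const) (use le in auto)
  then have "prob ?N = 0" by (simp add: measure_le_0_iff)
  then have "AE \<omega> in M. \<not> (\<forall>k. wait k \<omega> \<le> s)"
    by (subst (asm) prob_Collect_eq_0) auto
  then show ?thesis by (simp add: not_le)
qed

text \<open>The third assumption keeps the set of past events finite; otherwise its \<open>card\<close> would be \<open>0\<close>.\<close>

lemma event_count_eq_iff:
  assumes "\<omega> \<in> space M" and pos: "\<forall>k. 0 < wait k \<omega>" and "\<exists>k. s < wait k \<omega>" and "0 \<le> s"
  shows "event_count S s \<omega> = n \<longleftrightarrow> S n \<omega> \<le> s \<and> s < S (Suc n) \<omega>"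
proof -
  have mono: "strict_mono (\<lambda>k. S k \<omega>)"
    using pos by (simp add: strict_mono_Suc_iff wait_def)
  have S0: "S 0 \<omega> = 0" using assms(1) by (rule S_0)
  have *: "event_count S s \<omega> = n" if "S n \<omega> \<le> s" "s < S (Suc n) \<omega>" for n
  proof -
    have "{k. 1 \<le> k \<and> S k \<omega> \<le> s} = {1..n}"
    proof (intro set_eqI iffI)
      fix k assume "k \<in> {k. 1 \<le> k \<and> S k \<omega> \<le> s}"
      then have "1 \<le> k" "S k \<omega> < S (Suc n) \<omega>" using that by auto
      then show "k \<in> {1..n}" using strict_mono_less[OF mono] by auto
    next
      fix k assume "k \<in> {1..n}"
      then have "S k \<omega> \<le> S n \<omega>" using strict_mono_less_eq[OF mono] by auto
      then show "k \<in> {k. 1 \<le> k \<and> S k \<omega> \<le> s}" using that \<open>k \<in> {1..n}\<close> by auto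
    qed
    then show ?thesis by (simp add: event_count_def)
  qed
  obtain k where "s < wait k \<omega>" using assms(3) by blast
  moreover have "0 \<le> S k \<omega>" using strict_mono_less_eq[OF mono, of 0 k] S0 by simp
  ultimately have "s < S (Suc k) \<omega>" by (simp add: wait_def)
  define N where "N = (LEAST k. s < S (Suc k) \<omega>)"
  have "s < S (Suc N) \<omega>" unfolding N_def by (rule LeastI) fact
  moreover have "S N \<omega> \<le> s"
  proof (cases N)
    case 0 then show ?thesis using S0 assms(4) by simp
  next
    case (Suc j)
    then have "\<not> s < S (Suc j) \<omega>" unfolding N_def by (intro not_less_Least) simp
    then show ?thesis using Suc by simp
  qed
  ultimately show ?thesis using * by blast
qed

end

lemma tilted_power_bound:
  assumes "0 < lam" "0 \<le> u"
  shows "\<bar>tilted_power lam s i u\<bar> \<le> s ^ i / fact i * exp (lam * s) * indicator {..s} u"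
proof (cases "u \<le> s")
  case True
  then show ?thesis using assms
    by (auto simp: tilted_power_def abs_mult intro!: mult_mono divide_right_mono power_mono)
qed (simp add: tilted_power_def)

section \<open>Moments accumulated leg by leg\<close>

context random_flight
begin

lemma travelled_bound: "\<forall>k. 0 < wait k \<omega> \<Longrightarrow> \<bar>travelled n \<omega>\<bar> \<le> elapsed n \<omega>"
  unfolding travelled_def elapsed_def
  by (rule order_trans[OF sum_abs sum_mono])
    (auto simp: abs_mult less_imp_le intro!: mult_right_le_one_le)

lemma angle_expectation: "(\<integral>\<omega>. cos (\<theta> (Suc n) \<omega>) ^ b \<partial>M) = gegenbauer_moment (real m) b"
  by (rule angle_moment[OF prob_space_axioms angle_distr]) simp

text \<open>The past depends on the first n angles and waits, the next leg on the following pair, so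
  they are independent; within the pair the angle separates from the wait. The bound is imposed on
  the region \<bar>z\<bar> \<le> u, 0 \<le> x, where the values lie almost surely.\<close>

lemma expectation_next_leg:
  fixes g :: "real \<Rightarrow> real \<Rightarrow> real \<Rightarrow> real"
  assumes g [measurable]: "(\<lambda>(z, u, x). g z u x) \<in> borel_measurable (borel \<Otimes>\<^sub>M borel \<Otimes>\<^sub>M borel)"
    and bd: "\<And>z u x. \<bar>z\<bar> \<le> u \<Longrightarrow> 0 \<le> x \<Longrightarrow> \<bar>g z u x\<bar> \<le> B"
  shows "integrable M (\<lambda>\<omega>. g (travelled n \<omega>) (elapsed n \<omega>) (wait n \<omega>) * cos (\<theta> (Suc n) \<omega>) ^ b)"
      (is "integrable M ?f")
    and "(\<integral>\<omega>. g (travelled n \<omega>) (elapsed n \<omega>) (wait n \<omega>) * cos (\<theta> (Suc n) \<omega>) ^ b \<partial>M)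
      = gegenbauer_moment (real m) b *
        (\<integral>\<omega>. \<integral>x. exponential_density lam x * g (travelled n \<omega>) (elapsed n \<omega>) x \<partial>lborel \<partial>M)"
proof -
  have gM [measurable]: "(\<lambda>y. g (a y) (b y) (c y)) \<in> borel_measurable N"
    if [measurable]: "a \<in> borel_measurable N" "b \<in> borel_measurable N" "c \<in> borel_measurable N"
    for a b c and N :: "'b measure"
    using measurable_compose[OF _ g, of "\<lambda>y. (a y, b y, c y)" N] by simp
  show int: "integrable M ?f"
  proof (rule integrable_const_bound[of _ B])
    show "AE \<omega> in M. norm (?f \<omega>) \<le> B"
      using AE_wait_pos
    proof eventually_elim
      case (elim \<omega>)
      then have "\<bar>?f \<omega>\<bar> \<le> \<bar>g (travelled n \<omega>) (elapsed n \<omega>) (wait n \<omega>)\<bar>"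
        by (simp add: abs_mult power_abs power_le_one mult_right_le_one_le)
      also have "\<dots> \<le> B"
        using elim by (intro bd travelled_bound) (auto simp: less_imp_le)
      finally show ?case by simp
    qed
  qed measurable
  define A :: "(nat + nat) set" where "A = Inl ` {..<n} \<union> Inr ` {..<n}"
  define C :: "(nat + nat) set" where "C = {Inl n, Inr n}"
  define Z :: "(nat + nat \<Rightarrow> real) \<Rightarrow> real" where "Z f = (\<Sum>k<n. f (Inr k) * cos (f (Inl k)))" for f
  define U :: "(nat + nat \<Rightarrow> real) \<Rightarrow> real" where "U f = (\<Sum>k<n. f (Inr k))" for f
  define h where "h = (\<lambda>(f, f'). g (Z f) (U f) (f' (Inr n)) * cos (f' (Inl n)) ^ b)"
  have [measurable]: "Z \<in> borel_measurable (Pi\<^sub>M A (\<lambda>_. borel))" "U \<in> borel_measurable (Pi\<^sub>M A (\<lambda>_. borel))"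
  proof -
    have [measurable]: "(\<lambda>f. f (Inr k)) \<in> borel_measurable (Pi\<^sub>M A (\<lambda>_. borel :: real measure))"
      "(\<lambda>f. f (Inl k)) \<in> borel_measurable (Pi\<^sub>M A (\<lambda>_. borel :: real measure))" if "k < n" for k
      using that by (auto intro!: measurable_component_singleton simp: A_def)
    show "Z \<in> borel_measurable (Pi\<^sub>M A (\<lambda>_. borel))" "U \<in> borel_measurable (Pi\<^sub>M A (\<lambda>_. borel))"
      unfolding Z_def[abs_def] U_def[abs_def]
      by (auto intro!: borel_measurable_sum borel_measurable_times)
  qed
  have [measurable]: "(\<lambda>f. f (Inr n)) \<in> borel_measurable (Pi\<^sub>M C (\<lambda>_. borel :: real measure))"
      "(\<lambda>f. f (Inl n)) \<in> borel_measurable (Pi\<^sub>M C (\<lambda>_. borel :: real measure))"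
    by (auto intro!: measurable_component_singleton simp: C_def)
  have [measurable]: "h \<in> borel_measurable (Pi\<^sub>M A (\<lambda>_. borel) \<Otimes>\<^sub>M Pi\<^sub>M C (\<lambda>_. borel))"
    unfolding h_def by measurable
  have ZU: "Z (\<lambda>i\<in>A. source i \<omega>) = travelled n \<omega>" "U (\<lambda>i\<in>A. source i \<omega>) = elapsed n \<omega>" for \<omega>
    by (auto simp: Z_def U_def A_def source_def travelled_def elapsed_def intro!: sum.cong)
  have h: "h (\<lambda>i\<in>A. source i \<omega>, \<lambda>i\<in>C. source i \<omega>')
      = g (travelled n \<omega>) (elapsed n \<omega>) (wait n \<omega>') * cos (\<theta> (Suc n) \<omega>') ^ b" for \<omega> \<omega>'
    by (simp add: h_def ZU) (simp add: C_def source_def)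
  have "(\<integral>\<omega>. ?f \<omega> \<partial>M)
      = (\<integral>\<omega>. \<integral>\<omega>'. g (travelled n \<omega>) (elapsed n \<omega>) (wait n \<omega>') * cos (\<theta> (Suc n) \<omega>') ^ b \<partial>M \<partial>M)"
  proof -
    have "A \<inter> C = {}" by (auto simp: A_def C_def)
    then have "indep_var (Pi\<^sub>M A (\<lambda>_. borel)) (\<lambda>\<omega>. \<lambda>i\<in>A. source i \<omega>) (Pi\<^sub>M C (\<lambda>_. borel)) (\<lambda>\<omega>. \<lambda>i\<in>C. source i \<omega>)"
      by (rule indep_var_restrict[OF indep_source]) auto
    from indep_var_integral_iterated[OF this, of h] show ?thesis
      unfolding h using int by simp
  qed
  also have "\<dots> = (\<integral>\<omega>. gegenbauer_moment (real m) b *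
        (\<integral>x. exponential_density lam x * g (travelled n \<omega>) (elapsed n \<omega>) x \<partial>lborel) \<partial>M)"
  proof (rule integral_cong_AE)
    show "AE \<omega> in M. (\<integral>\<omega>'. g (travelled n \<omega>) (elapsed n \<omega>) (wait n \<omega>') * cos (\<theta> (Suc n) \<omega>') ^ b \<partial>M)
       = gegenbauer_moment (real m) b *
        (\<integral>x. exponential_density lam x * g (travelled n \<omega>) (elapsed n \<omega>) x \<partial>lborel)"
      using AE_wait_pos
    proof eventually_elim
      case (elim \<omega>)
      define z u where "z = travelled n \<omega>" and "u = elapsed n \<omega>"
      have zu: "\<bar>z\<bar> \<le> u" unfolding z_def u_def by (rule travelled_bound[OF elim])
      have [measurable]: "g z u \<in> borel_measurable borel"
        using measurable_compose[OF _ g, of "\<lambda>x. (z, u, x)" borel] by simp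
      \<comment> \<open>With the past frozen at z and u, independence of wait and angle inside the
        next leg splits the inner integral into a product.\<close>
      have "indep_vars (\<lambda>_. borel) (\<lambda>j. source (case_bool (Inr n) (Inl n) j)) (UNIV :: bool set)"
        by (rule indep_vars_reindex[OF indep_source]) (auto simp: inj_on_def split: bool.splits)
      also have "(\<lambda>j. source (case_bool (Inr n) (Inl n) j)) = case_bool (source (Inr n)) (source (Inl n))"
        by (auto split: bool.split)
      also have "(\<lambda>_. borel :: real measure) = case_bool borel borel"
        by (auto split: bool.split)
      finally have "indep_var borel (source (Inr n)) borel (source (Inl n))"
        unfolding indep_var_def .
      then have "indep_var borel (g z u \<circ> source (Inr n)) borel ((\<lambda>x. cos x ^ b) \<circ> source (Inl n))"
        by (rule indep_var_compose) measurable
      then have ind: "indep_var borel (\<lambda>\<omega>. g z u (wait n \<omega>)) borel (\<lambda>\<omega>. cos (\<theta> (Suc n) \<omega>) ^ b)"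
        by (simp add: o_def source_def)
      have "integrable M (\<lambda>\<omega>. g z u (wait n \<omega>))"
      proof (rule integrable_const_bound[of _ B])
        show "AE \<omega> in M. norm (g z u (wait n \<omega>)) \<le> B"
          using AE_wait_pos by eventually_elim (use zu in \<open>auto intro!: bd simp: less_imp_le\<close>)
      qed measurable
      moreover have "integrable M (\<lambda>\<omega>. cos (\<theta> (Suc n) \<omega>) ^ b)"
        by (rule integrable_const_bound[of _ 1]) (auto simp: power_abs power_le_one)
      ultimately have "(\<integral>\<omega>'. g z u (wait n \<omega>') * cos (\<theta> (Suc n) \<omega>') ^ b \<partial>M)
          = (\<integral>\<omega>'. g z u (wait n \<omega>') \<partial>M) * gegenbauer_moment (real m) b"
        using indep_var_lebesgue_integral[OF ind] by (simp add: angle_expectation)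
      also have "(\<integral>\<omega>'. g z u (wait n \<omega>') \<partial>M) = (\<integral>x. exponential_density lam x * g z u x \<partial>lborel)"
        using rate_pos by (intro distributed_integral[OF wait_distr, symmetric]) (auto simp: exponential_density_def)
      finally show ?case by (simp add: z_def u_def mult.commute)
    qed
  qed measurable
  finally show "(\<integral>\<omega>. ?f \<omega> \<partial>M) = gegenbauer_moment (real m) b *
        (\<integral>\<omega>. \<integral>x. exponential_density lam x * g (travelled n \<omega>) (elapsed n \<omega>) x \<partial>lborel \<partial>M)"
    by simp
qed

text \<open>Expand the k-th power binomially in the last leg and integrate that leg out. The
  binomial coefficient turns j! (k - j)! into k!, and what remains is the Cauchy product of J with
  its n-th power. The index i must be arbitrary, since each leg replaces it by i + j + 1.\<close>

lemma travelled_moment: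
  assumes "0 \<le> s"
  shows "(\<integral>\<omega>. travelled n \<omega> ^ k * tilted_power lam s i (elapsed n \<omega>) \<partial>M)
    = lam ^ n * fact k * fps_nth (gegenbauer_fps (real m) ^ n) k * s ^ (i + k + n) / fact (i + k + n)"
proof (induction n arbitrary: k i)
  case 0
  then show ?case using assms
    by (cases k) (auto simp: travelled_def elapsed_def tilted_power_def prob_space)
next
  case (Suc n)
  define g where "g j z u x = z ^ (k - j) * (x ^ j * tilted_power lam s i (u + x))" for j :: nat and z u x :: real
  define f where "f j \<omega> = g j (travelled n \<omega>) (elapsed n \<omega>) (wait n \<omega>) * cos (\<theta> (Suc n) \<omega>) ^ j" for j \<omega>
  have meas: "(\<lambda>(z, u, x). g j z u x) \<in> borel_measurable (borel \<Otimes>\<^sub>M borel \<Otimes>\<^sub>M borel)" for j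
    unfolding g_def by measurable
  have bd: "\<bar>g j z u x\<bar> \<le> s ^ (k - j) * (s ^ j * (s ^ i / fact i * exp (lam * s)))"
    if "\<bar>z\<bar> \<le> u" "0 \<le> x" for j z u x
  proof (cases "u + x \<le> s")
    case True
    have "\<bar>tilted_power lam s i (u + x)\<bar> \<le> s ^ i / fact i * exp (lam * s)"
      using tilted_power_bound[OF rate_pos, of "u + x" s i] that True by simp
    then show ?thesis using that True assms unfolding g_def abs_mult power_abs
      by (intro mult_mono power_mono) auto
  next
    case False
    then show ?thesis using assms by (simp add: g_def tilted_power_def)
  qed
  have f: "integrable M (f j)" "(\<integral>\<omega>. f j \<omega> \<partial>M) = gegenbauer_moment (real m) j * (lam * fact j *
      (lam ^ n * fact (k - j) * fps_nth (gegenbauer_fps (real m) ^ n) (k - j) *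
        s ^ (i + k + Suc n) / fact (i + k + Suc n)))" if "j \<le> k" for j
  proof -
    show "integrable M (f j)"
      unfolding f_def by (rule expectation_next_leg(1)[OF meas bd])
    have inner: "(\<integral>x. exponential_density lam x * g j z u x \<partial>lborel)
        = lam * fact j * (z ^ (k - j) * tilted_power lam s (i + j + 1) u)" for z u
    proof -
      have "(\<integral>x. exponential_density lam x * g j z u x \<partial>lborel)
          = (\<integral>x. z ^ (k - j) * (exponential_density lam x * (x ^ j * tilted_power lam s i (u + x))) \<partial>lborel)"
        by (simp add: g_def mult_ac)
      then show ?thesis using tilted_power_convolution[OF rate_pos, of j s i u] by simp
    qed
    have "(\<integral>\<omega>. f j \<omega> \<partial>M) = gegenbauer_moment (real m) j *
        (\<integral>\<omega>. \<integral>x. exponential_density lam x * g j (travelled n \<omega>) (elapsed n \<omega>) x \<partial>lborel \<partial>M)"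
      unfolding f_def by (rule expectation_next_leg(2)[OF meas bd])
    also have "\<dots> = gegenbauer_moment (real m) j *
        (\<integral>\<omega>. lam * fact j * (travelled n \<omega> ^ (k - j) * tilted_power lam s (i + j + 1) (elapsed n \<omega>)) \<partial>M)"
      unfolding inner ..
    also have "(\<integral>\<omega>. lam * fact j * (travelled n \<omega> ^ (k - j) * tilted_power lam s (i + j + 1) (elapsed n \<omega>)) \<partial>M)
        = lam * fact j * (lam ^ n * fact (k - j) * fps_nth (gegenbauer_fps (real m) ^ n) (k - j) *
          s ^ (i + j + 1 + (k - j) + n) / fact (i + j + 1 + (k - j) + n))"
      by (simp only: integral_mult_right_zero Suc.IH)
    also have "i + j + 1 + (k - j) + n = i + k + Suc n" using that by simp
    finally show "(\<integral>\<omega>. f j \<omega> \<partial>M) = gegenbauer_moment (real m) j * (lam * fact j *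
      (lam ^ n * fact (k - j) * fps_nth (gegenbauer_fps (real m) ^ n) (k - j) *
        s ^ (i + k + Suc n) / fact (i + k + Suc n)))" .
  qed
  have "travelled (Suc n) \<omega> ^ k * tilted_power lam s i (elapsed (Suc n) \<omega>)
      = (\<Sum>j\<le>k. real (k choose j) * f j \<omega>)" for \<omega>
  proof -
    have t: "travelled (Suc n) \<omega> = wait n \<omega> * cos (\<theta> (Suc n) \<omega>) + travelled n \<omega>"
      by (simp add: travelled_def)
    have e: "elapsed (Suc n) \<omega> = elapsed n \<omega> + wait n \<omega>" by (simp add: elapsed_def)
    show ?thesis
      unfolding t e binomial_ring sum_distrib_right
      by (intro sum.cong refl) (simp add: f_def g_def power_mult_distrib mult_ac)
  qed
  then have "(\<integral>\<omega>. travelled (Suc n) \<omega> ^ k * tilted_power lam s i (elapsed (Suc n) \<omega>) \<partial>M)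
      = (\<Sum>j\<le>k. real (k choose j) * (\<integral>\<omega>. f j \<omega> \<partial>M))"
    by (simp add: f(1))
  also have "\<dots> = (\<Sum>j\<le>k. lam ^ Suc n * fact k * s ^ (i + k + Suc n) / fact (i + k + Suc n) *
      (gegenbauer_moment (real m) j * fps_nth (gegenbauer_fps (real m) ^ n) (k - j)))"
  proof (rule sum.cong[OF refl])
    fix j assume "j \<in> {..k}"
    then have j: "j \<le> k" by simp
    have "fact k = real (k choose j) * fact j * fact (k - j)"
      using binomial_fact_lemma[OF j] by (metis (no_types) mult.assoc mult.commute of_nat_fact of_nat_mult)
    then show "real (k choose j) * (\<integral>\<omega>. f j \<omega> \<partial>M) = lam ^ Suc n * fact k * s ^ (i + k + Suc n) / fact (i + k + Suc n) *
      (gegenbauer_moment (real m) j * fps_nth (gegenbauer_fps (real m) ^ n) (k - j))"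
      unfolding f(2)[OF j] by (simp add: mult_ac)
  qed
  also have "\<dots> = lam ^ Suc n * fact k * s ^ (i + k + Suc n) / fact (i + k + Suc n) *
      fps_nth (gegenbauer_fps (real m) ^ Suc n) k"
    by (simp add: fps_mult_nth sum_distrib_left gegenbauer_fps_def atMost_atLeast0)
  finally show ?case by (simp add: mult_ac)
qed

end

section \<open>Conditional law of the position given the number of events\<close>

lemma gegenbauer_law_real_distribution:
  assumes "0 \<le> v" shows "real_distribution (gegenbauer_law v)"
proof -
  have "prob_space (gegenbauer_law v)"
    by (rule prob_spaceI) (simp add: gegenbauer_law_def emeasure_density gegenbauer_density_nn_integral[OF assms])
  then show ?thesis
    by (simp add: real_distribution_def real_distribution_axioms_def gegenbauer_law_def)
qed

lemma gegenbauer_law_AE: "AE x in gegenbauer_law v. \<bar>x\<bar> \<le> 1"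
  unfolding gegenbauer_law_def by (subst AE_density) (auto simp: gegenbauer_density_def)

lemma gegenbauer_law_moment:
  assumes "0 \<le> v" shows "(\<integral>x. x ^ k \<partial>gegenbauer_law v) = gegenbauer_moment v k"
proof -
  have "(\<integral>x. x ^ k \<partial>gegenbauer_law v) = (\<integral>x. gegenbauer_density v x *\<^sub>R x ^ k \<partial>lborel)"
    unfolding gegenbauer_law_def
    using gegenbauer_density_nonneg[OF assms] by (intro integral_density) auto
  then show ?thesis using gegenbauer_density_moment(2)[OF assms] by simp
qed

definition leg_shape :: "nat \<Rightarrow> nat \<Rightarrow> real" where
  "leg_shape m n = (if m = 0 then real n / 2 else real n + 1)"

lemma leg_shape_nonneg [simp]: "0 \<le> leg_shape m n"
  by (simp add: leg_shape_def)

lemma gegenbauer_fps_power: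
  assumes "m \<in> {0, 1}"
  shows "fps_nth (gegenbauer_fps (real m) ^ Suc n) k * fact k * fact n / fact (n + k)
    = gegenbauer_moment (leg_shape m n) k"
  using assms gegenbauer_fps_power_0[of n k] gegenbauer_fps_power_1[of n k]
  by (auto simp: leg_shape_def)

context random_flight
begin

text \<open>Almost surely the event that exactly n events occur by time s, written with waiting
  times so that no cardinality enters.\<close>

definition final_leg :: "nat \<Rightarrow> real \<Rightarrow> 'a set" where
  "final_leg n s = {\<omega>\<in>space M. elapsed n \<omega> \<le> s \<and> s < elapsed n \<omega> + wait n \<omega>}"

definition position :: "nat \<Rightarrow> real \<Rightarrow> 'a \<Rightarrow> real" where
  "position n s \<omega> = travelled n \<omega> + (s - elapsed n \<omega>) * cos (\<theta> (Suc n) \<omega>)"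

lemma final_leg_events [measurable]: "final_leg n s \<in> events"
  unfolding final_leg_def by measurable

lemma position_measurable [measurable]: "random_variable borel (position n s)"
  unfolding position_def[abs_def] by measurable

text \<open>The leg in progress has length s - u, fixed by the past; its waiting time enters only
  through the tail exp(- lam (s - u)). So (s - u)^j becomes j! times \<open>tilted_power\<close> of
  index j, and this leg contributes a factor J but no factor lam.\<close>

lemma final_leg_moment:
  assumes s: "0 \<le> s"
  shows "(\<integral>\<omega>. position n s \<omega> ^ k * indicator (final_leg n s) \<omega> \<partial>M)
    = exp (- lam * s) * lam ^ n * fact k * fps_nth (gegenbauer_fps (real m) ^ Suc n) k *
      s ^ (k + n) / fact (k + n)"
proof -
  define g where "g j z u x = z ^ (k - j) * ((s - u) ^ j * indicator {..s} u * indicator {s - u<..} x)"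
    for j :: nat and z u x :: real
  define f where "f j \<omega> = g j (travelled n \<omega>) (elapsed n \<omega>) (wait n \<omega>) * cos (\<theta> (Suc n) \<omega>) ^ j" for j \<omega>
  have meas: "(\<lambda>(z, u, x). g j z u x) \<in> borel_measurable (borel \<Otimes>\<^sub>M borel \<Otimes>\<^sub>M borel)" for j
    unfolding g_def indicator_def greaterThan_iff atMost_iff by measurable
  have bd: "\<bar>g j z u x\<bar> \<le> s ^ (k - j) * s ^ j" if "\<bar>z\<bar> \<le> u" "0 \<le> x" for j z u x
  proof (cases "u \<le> s")
    case True
    have "\<bar>g j z u x\<bar> \<le> \<bar>z\<bar> ^ (k - j) * (s - u) ^ j"
      using True by (simp add: g_def abs_mult power_abs indicator_def)
    also have "\<dots> \<le> s ^ (k - j) * s ^ j"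
      using that True by (intro mult_mono power_mono) auto
    finally show ?thesis .
  next
    case False
    then show ?thesis using s by (simp add: g_def)
  qed
  have f: "integrable M (f j)" "(\<integral>\<omega>. f j \<omega> \<partial>M) = gegenbauer_moment (real m) j * (exp (- lam * s) * fact j *
      (lam ^ n * fact (k - j) * fps_nth (gegenbauer_fps (real m) ^ n) (k - j) *
        s ^ (k + n) / fact (k + n)))" if "j \<le> k" for j
  proof -
    show "integrable M (f j)"
      unfolding f_def by (rule expectation_next_leg(1)[OF meas bd])
    have inner: "(\<integral>x. exponential_density lam x * g j z u x \<partial>lborel)
        = exp (- lam * s) * fact j * (z ^ (k - j) * tilted_power lam s j u)" for z u
    proof -
      have "(\<integral>x. exponential_density lam x * g j z u x \<partial>lborel)
          = (\<integral>x. z ^ (k - j) * (s - u) ^ j * indicator {..s} u *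
              (exponential_density lam x * indicator {s - u<..} x) \<partial>lborel)"
        by (simp add: g_def mult_ac)
      also have "\<dots> = z ^ (k - j) * (s - u) ^ j * indicator {..s} u *
          (\<integral>x. exponential_density lam x * indicator {s - u<..} x \<partial>lborel)"
        by simp
      also have "\<dots> = exp (- lam * s) * fact j * (z ^ (k - j) * tilted_power lam s j u)"
      proof (cases "u \<le> s")
        case True
        have "exp (- lam * (s - u)) = exp (- lam * s) * exp (lam * u)"
          by (simp add: algebra_simps flip: exp_add)
        then have "(\<integral>x. exponential_density lam x * indicator {s - u<..} x \<partial>lborel)
            = exp (- lam * s) * exp (lam * u)"
          using exponential_density_tail_integral[OF rate_pos, of "s - u"] True by simp
        then show ?thesis using True by (simp only:) (simp add: tilted_power_def)
      qed (simp add: tilted_power_def)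
      finally show ?thesis .
    qed
    have "(\<integral>\<omega>. f j \<omega> \<partial>M) = gegenbauer_moment (real m) j *
        (\<integral>\<omega>. \<integral>x. exponential_density lam x * g j (travelled n \<omega>) (elapsed n \<omega>) x \<partial>lborel \<partial>M)"
      unfolding f_def by (rule expectation_next_leg(2)[OF meas bd])
    also have "\<dots> = gegenbauer_moment (real m) j *
        (\<integral>\<omega>. exp (- lam * s) * fact j * (travelled n \<omega> ^ (k - j) * tilted_power lam s j (elapsed n \<omega>)) \<partial>M)"
      unfolding inner ..
    also have "(\<integral>\<omega>. exp (- lam * s) * fact j * (travelled n \<omega> ^ (k - j) * tilted_power lam s j (elapsed n \<omega>)) \<partial>M)
        = exp (- lam * s) * fact j * (lam ^ n * fact (k - j) * fps_nth (gegenbauer_fps (real m) ^ n) (k - j) *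
          s ^ (j + (k - j) + n) / fact (j + (k - j) + n))"
      by (simp only: integral_mult_right_zero travelled_moment[OF s])
    also have "j + (k - j) + n = k + n" using that by simp
    finally show "(\<integral>\<omega>. f j \<omega> \<partial>M) = gegenbauer_moment (real m) j * (exp (- lam * s) * fact j *
      (lam ^ n * fact (k - j) * fps_nth (gegenbauer_fps (real m) ^ n) (k - j) *
        s ^ (k + n) / fact (k + n)))" .
  qed
  have "(\<integral>\<omega>. position n s \<omega> ^ k * indicator (final_leg n s) \<omega> \<partial>M)
      = (\<integral>\<omega>. (\<Sum>j\<le>k. real (k choose j) * f j \<omega>) \<partial>M)"
  proof (rule Bochner_Integration.integral_cong[OF refl])
    fix \<omega> assume "\<omega> \<in> space M"
    then have i: "indicator (final_leg n s) \<omega> = indicator {..s} (elapsed n \<omega>) *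
        (indicator {s - elapsed n \<omega><..} (wait n \<omega>) :: real)"
      by (auto simp: final_leg_def indicator_def)
    have p: "position n s \<omega> = (s - elapsed n \<omega>) * cos (\<theta> (Suc n) \<omega>) + travelled n \<omega>"
      by (simp add: position_def)
    show "position n s \<omega> ^ k * indicator (final_leg n s) \<omega> = (\<Sum>j\<le>k. real (k choose j) * f j \<omega>)"
      unfolding i p binomial_ring sum_distrib_right
      by (intro sum.cong refl) (simp add: f_def g_def power_mult_distrib mult_ac)
  qed
  also have "\<dots> = (\<Sum>j\<le>k. real (k choose j) * (\<integral>\<omega>. f j \<omega> \<partial>M))"
    by (simp add: f(1))
  also have "\<dots> = (\<Sum>j\<le>k. exp (- lam * s) * lam ^ n * fact k * s ^ (k + n) / fact (k + n) *
      (gegenbauer_moment (real m) j * fps_nth (gegenbauer_fps (real m) ^ n) (k - j)))"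
  proof (rule sum.cong[OF refl])
    fix j assume "j \<in> {..k}"
    then have j: "j \<le> k" by simp
    have "fact k = real (k choose j) * fact j * fact (k - j)"
      using binomial_fact_lemma[OF j] by (metis (no_types) mult.assoc mult.commute of_nat_fact of_nat_mult)
    then show "real (k choose j) * (\<integral>\<omega>. f j \<omega> \<partial>M) = exp (- lam * s) * lam ^ n * fact k * s ^ (k + n) / fact (k + n) *
      (gegenbauer_moment (real m) j * fps_nth (gegenbauer_fps (real m) ^ n) (k - j))"
      unfolding f(2)[OF j] by (simp add: mult_ac)
  qed
  also have "\<dots> = exp (- lam * s) * lam ^ n * fact k * s ^ (k + n) / fact (k + n) *
      fps_nth (gegenbauer_fps (real m) ^ Suc n) k"
    by (simp add: fps_mult_nth sum_distrib_left gegenbauer_fps_def atMost_atLeast0)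
  finally show ?thesis by (simp add: mult_ac)
qed

lemma prob_final_leg:
  assumes "0 \<le> s" shows "prob (final_leg n s) = exp (- lam * s) * (lam * s) ^ n / fact n"
proof -
  have "fps_nth (gegenbauer_fps (real m) ^ Suc n) 0 = 1"
    by (simp add: fps_power_zeroth gegenbauer_fps_def)
  then show ?thesis
    using final_leg_moment[OF assms, of n 0] by (simp add: power_mult_distrib mult_ac)
qed

text \<open>Speed at most 1 keeps the normalised position in [-1, 1], so its moments decide.
  Dividing by the Poisson probability of the event removes lam, the exponential and the powers of
  s.\<close>

lemma position_law:
  assumes m: "m \<in> {0, 1}" and s: "0 < s" and [measurable]: "A \<in> sets borel"
  shows "prob {\<omega>\<in>final_leg n s. position n s \<omega> / s \<in> A} / prob (final_leg n s)
    = measure (gegenbauer_law (leg_shape m n)) A"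
proof -
  define E where "E = final_leg n s"
  define Y where "Y \<omega> = position n s \<omega> / s" for \<omega>
  have [measurable]: "E \<in> events" by (simp add: E_def)
  have [measurable]: "random_variable borel Y" unfolding Y_def[abs_def] by measurable
  have E: "prob E = exp (- lam * s) * (lam * s) ^ n / fact n" and Epos: "prob E > 0"
    using prob_final_leg[of s n] s rate_pos by (auto simp: E_def)
  \<comment> \<open>The conditional probability given E, taken as a density so that integrals reduce
    to integrals over M.\<close>
  define N where "N = density M (\<lambda>\<omega>. ennreal (indicator E \<omega> / prob E))"
  have emeasure_N: "emeasure N B = ennreal (prob (B \<inter> E) / prob E)" if [measurable]: "B \<in> events" for B
  proof -
    have "emeasure N B = (\<integral>\<^sup>+ \<omega>. ennreal (1 / prob E) * indicator (B \<inter> E) \<omega> \<partial>M)"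
      unfolding N_def by (subst emeasure_density) (auto intro!: nn_integral_cong simp: indicator_def)
    also have "\<dots> = ennreal (prob (B \<inter> E) / prob E)"
      by (subst nn_integral_cmult_indicator) (auto simp: emeasure_eq_measure ennreal_mult'[symmetric])
    finally show ?thesis .
  qed
  have sp: "space N = space M" "sets N = events" by (auto simp: N_def)
  interpret N: prob_space N
  proof (rule prob_spaceI)
    have "space M \<inter> E = E" using sets.sets_into_space[OF \<open>E \<in> events\<close>] by blast
    then show "emeasure N (space N) = 1"
      using emeasure_N[of "space M"] Epos by (simp add: sp)
  qed
  have [measurable]: "Y \<in> borel_measurable N" by (simp add: N_def)
  have "distr N borel Y = gegenbauer_law (leg_shape m n)"
  proof (rule real_distribution_eqI_moments)
    show "real_distribution (distr N borel Y)" by (rule N.real_distribution_distr) measurable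
    show "real_distribution (gegenbauer_law (leg_shape m n))"
      by (rule gegenbauer_law_real_distribution) simp
    show "AE x in gegenbauer_law (leg_shape m n). \<bar>x\<bar> \<le> 1" by (rule gegenbauer_law_AE)
    have "AE \<omega> in M. \<omega> \<in> E \<longrightarrow> \<bar>Y \<omega>\<bar> \<le> 1"
      using AE_wait_pos
    proof eventually_elim
      case (elim \<omega>)
      show ?case
      proof
        assume "\<omega> \<in> E"
        then have le: "elapsed n \<omega> \<le> s" by (simp add: E_def final_leg_def)
        have "\<bar>position n s \<omega>\<bar> \<le> \<bar>travelled n \<omega>\<bar> + \<bar>s - elapsed n \<omega>\<bar> * \<bar>cos (\<theta> (Suc n) \<omega>)\<bar>"
          unfolding position_def abs_mult[symmetric] by (rule abs_triangle_ineq)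
        also have "\<dots> \<le> elapsed n \<omega> + (s - elapsed n \<omega>)"
          using le by (intro add_mono travelled_bound[OF elim]) (auto intro!: mult_right_le_one_le)
        finally show "\<bar>Y \<omega>\<bar> \<le> 1" using s by (simp add: Y_def)
      qed
    qed
    then show "AE x in distr N borel Y. \<bar>x\<bar> \<le> 1"
      unfolding N_def by (subst AE_distr_iff) (auto simp: AE_density indicator_def)
    fix k
    have "(\<integral>x. x ^ k \<partial>distr N borel Y) = (\<integral>\<omega>. Y \<omega> ^ k \<partial>N)"
      by (rule integral_distr) measurable
    also have "\<dots> = (\<integral>\<omega>. (indicator E \<omega> / prob E) *\<^sub>R Y \<omega> ^ k \<partial>M)"
      unfolding N_def by (rule integral_density) auto
    also have "\<dots> = (\<integral>\<omega>. 1 / (prob E * s ^ k) * (position n s \<omega> ^ k * indicator E \<omega>) \<partial>M)"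
      by (simp add: Y_def power_divide mult_ac)
    also have "\<dots> = 1 / (prob E * s ^ k) * (exp (- lam * s) * lam ^ n * fact k *
        fps_nth (gegenbauer_fps (real m) ^ Suc n) k * s ^ (k + n) / fact (k + n))"
      unfolding E_def by (subst integral_mult_right_zero, subst final_leg_moment) (use s in auto)
    also have "\<dots> = fps_nth (gegenbauer_fps (real m) ^ Suc n) k * fact k * fact n / fact (n + k)"
      unfolding E using s rate_pos
      by (simp add: power_add power_mult_distrib add.commute[of n k] field_simps del: power_Suc)
    also have "\<dots> = (\<integral>x. x ^ k \<partial>gegenbauer_law (leg_shape m n))"
      by (simp only: gegenbauer_fps_power[OF m] gegenbauer_law_moment leg_shape_nonneg)
    finally show "(\<integral>x. x ^ k \<partial>distr N borel Y) = (\<integral>x. x ^ k \<partial>gegenbauer_law (leg_shape m n))" .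
  qed
  then have "measure (gegenbauer_law (leg_shape m n)) A = measure (distr N borel Y) A" by simp
  also have "\<dots> = measure N (Y -` A \<inter> space M)"
    by (subst measure_distr) (auto simp: sp)
  also have "\<dots> = prob (Y -` A \<inter> space M \<inter> E) / prob E"
    by (simp add: measure_def emeasure_N)
  also have "Y -` A \<inter> space M \<inter> E = {\<omega>\<in>final_leg n s. position n s \<omega> / s \<in> A}"
    by (auto simp: Y_def E_def final_leg_def)
  finally show ?thesis by (simp add: E_def)
qed

text \<open>\<open>event_count\<close> agrees with the \<open>final_leg\<close> description only off
  a null set, so numerator and denominator of the conditional probability are exchanged up to null
  sets. The factor c, absent from \<open>position\<close>, returns here in c s w.\<close>

lemma cond_prob_flight:
  assumes m: "m \<in> {0, 1}" and s: "0 < s" and A [measurable]: "A \<in> sets borel"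
  shows "ennreal (\<P>(\<omega> in M. flight c S \<theta> s \<omega> \<in> A \<bar> event_count S s \<omega> = n))
    = (\<integral>\<^sup>+ w. ennreal (gegenbauer_density (leg_shape m n) w) * indicator A (c * s * w) \<partial>lborel)"
proof -
  have S [measurable]: "random_variable borel (S k)" for k
    using elapsed_measurable[of k] by (simp add: elapsed_eq_S cong: measurable_cong)
  have [measurable]: "random_variable (count_space UNIV) (event_count S s)"
    unfolding event_count_def[abs_def] by (rule measurable_card) measurable
  have flight: "flight c S \<theta> s \<omega> = c * position n s \<omega>"
    if "\<omega> \<in> space M" "event_count S s \<omega> = n" for \<omega>
  proof -
    have "flight c S \<theta> s \<omega> = c * (\<Sum>k<Suc n. ((if Suc k = n + 1 then s else S (Suc k) \<omega>) - S k \<omega>) * cos (\<theta> (Suc k) \<omega>))"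
      unfolding flight_def that(2)
      by (rule arg_cong[where f="(*) c"]) (rule sum.reindex_bij_witness[of _ Suc "\<lambda>k. k - 1"]; auto)
    also have "(\<Sum>k<Suc n. ((if Suc k = n + 1 then s else S (Suc k) \<omega>) - S k \<omega>) * cos (\<theta> (Suc k) \<omega>))
        = (\<Sum>k<n. ((if Suc k = n + 1 then s else S (Suc k) \<omega>) - S k \<omega>) * cos (\<theta> (Suc k) \<omega>))
          + (s - S n \<omega>) * cos (\<theta> (Suc n) \<omega>)"
      by simp
    also have "\<dots> = position n s \<omega>"
      using elapsed_eq_S[OF that(1)] by (simp add: position_def travelled_def wait_def)
    finally show ?thesis .
  qed
  have eq: "prob {\<omega>\<in>space M. c * position n s \<omega> \<in> B \<and> event_count S s \<omega> = n}
      = prob {\<omega>\<in>final_leg n s. c * position n s \<omega> \<in> B}" if [measurable]: "B \<in> sets borel" for B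
  proof (rule finite_measure_eq_AE)
    have "{\<omega>\<in>final_leg n s. c * position n s \<omega> \<in> B} = final_leg n s \<inter> {\<omega>\<in>space M. c * position n s \<omega> \<in> B}"
      by (auto simp: final_leg_def)
    then show "{\<omega>\<in>final_leg n s. c * position n s \<omega> \<in> B} \<in> events" by simp
    show "AE \<omega> in M. \<omega> \<in> {\<omega>\<in>space M. c * position n s \<omega> \<in> B \<and> event_count S s \<omega> = n}
        \<longleftrightarrow> \<omega> \<in> {\<omega>\<in>final_leg n s. c * position n s \<omega> \<in> B}"
      using AE_wait_pos AE_wait_exceeds[OF less_imp_le[OF s]] AE_space
    proof eventually_elim
      case (elim \<omega>)
      then show ?case
        using event_count_eq_iff[OF elim(3,1,2) less_imp_le[OF s], of n] elapsed_eq_S[OF elim(3)]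
        by (auto simp: final_leg_def wait_def)
    qed
  qed measurable
  have "prob {\<omega>\<in>space M. flight c S \<theta> s \<omega> \<in> A \<and> event_count S s \<omega> = n}
      = prob {\<omega>\<in>space M. c * position n s \<omega> \<in> A \<and> event_count S s \<omega> = n}"
    by (rule arg_cong[where f=prob]) (auto simp: flight)
  also have "\<dots> = prob {\<omega>\<in>final_leg n s. position n s \<omega> / s \<in> {w. c * s * w \<in> A}}"
    unfolding eq[OF A] using s by simp
  finally have 1: "prob {\<omega>\<in>space M. flight c S \<theta> s \<omega> \<in> A \<and> event_count S s \<omega> = n}
      = prob {\<omega>\<in>final_leg n s. position n s \<omega> / s \<in> {w. c * s * w \<in> A}}" .
  have 2: "prob {\<omega>\<in>space M. event_count S s \<omega> = n} = prob (final_leg n s)"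
    using eq[of UNIV] by simp
  have "(\<lambda>w. c * s * w) \<in> borel_measurable borel" by measurable
  from measurable_sets[OF this A] have B [measurable]: "{w. c * s * w \<in> A} \<in> sets borel"
    by (simp add: vimage_def)
  have "\<P>(\<omega> in M. flight c S \<theta> s \<omega> \<in> A \<bar> event_count S s \<omega> = n)
      = measure (gegenbauer_law (leg_shape m n)) {w. c * s * w \<in> A}"
    unfolding cond_prob_def 1 2 by (rule position_law[OF m s B])
  also interpret G: real_distribution "gegenbauer_law (leg_shape m n)"
    by (rule gegenbauer_law_real_distribution) simp
  have "ennreal (measure (gegenbauer_law (leg_shape m n)) {w. c * s * w \<in> A})
      = emeasure (gegenbauer_law (leg_shape m n)) {w. c * s * w \<in> A}"
    by (simp add: G.emeasure_eq_measure)
  also have "\<dots> = (\<integral>\<^sup>+ w. ennreal (gegenbauer_density (leg_shape m n) w) * indicator {w. c * s * w \<in> A} w \<partial>lborel)"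
    unfolding gegenbauer_law_def using B by (intro emeasure_density) auto
  finally show ?thesis by (simp add: indicator_def)
qed

end

section \<open>The flight at an exponential time\<close>

text \<open>Legendre's duplication formula at k + 3/2, by induction from the value of Gamma at 1/2.
  It rewrites the normalising constant for \<open>m = 1\<close>.\<close>

lemma Gamma_half_integer_duplication:
  "fact (2 * k + 2) * sqrt pi = 4 ^ Suc k * Gamma (real k + 3/2) * fact (Suc k)"
proof (induction k)
  case 0
  have "Gamma (1/2 + 1 :: real) = 1/2 * Gamma (1/2)"
    by (rule Gamma_plus1) (auto elim!: nonpos_Ints_cases)
  then show ?case by (simp add: Gamma_one_half_real)
next
  case (Suc k)
  have "Gamma (real (Suc k) + 3/2) = Gamma ((real k + 3/2) + 1)" by (simp add: add_ac)
  also have "\<dots> = (real k + 3/2) * Gamma (real k + 3/2)"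
    by (rule Gamma_plus1) (auto elim!: nonpos_Ints_cases)
  finally have G: "Gamma (real (Suc k) + 3/2) = (real k + 3/2) * Gamma (real k + 3/2)" .
  have "(fact (2 * Suc k + 2) :: real) * sqrt pi
      = (2 * real k + 4) * (2 * real k + 3) * (fact (2 * k + 2) * sqrt pi)"
    by (simp add: algebra_simps)
  also have "\<dots> = 4 ^ Suc (Suc k) * ((real k + 3/2) * Gamma (real k + 3/2)) * fact (Suc (Suc k))"
    unfolding Suc.IH by (simp add: algebra_simps)
  finally show ?case unfolding G .
qed

section \<open>The flight density as a Poisson mixture\<close>

definition poisson_weight :: "real \<Rightarrow> real \<Rightarrow> nat \<Rightarrow> real" where
  "poisson_weight lam t n = exp (- (lam * t)) * (lam * t) ^ n / fact n"

lemma poisson_weight_nonneg [simp]: "0 < lam \<Longrightarrow> 0 < t \<Longrightarrow> 0 \<le> poisson_weight lam t n"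
  by (simp add: poisson_weight_def)

lemma poisson_weight_suminf:
  assumes "0 < lam" "0 < t" shows "(\<Sum>n. ennreal (poisson_weight lam t n)) = 1"
proof -
  have "(\<lambda>n. exp (- (lam * t)) * ((lam * t) ^ n /\<^sub>R fact n)) sums (exp (- (lam * t)) * exp (lam * t))"
    by (intro sums_mult exp_converges)
  then have "poisson_weight lam t sums 1"
    by (simp add: poisson_weight_def[abs_def] divide_inverse mult_ac flip: exp_add)
  then have "(\<Sum>n. ennreal (poisson_weight lam t n)) = ennreal 1"
    using assms by (intro suminf_ennreal_eq) auto
  then show ?thesis by simp
qed

definition mixture_term :: "nat \<Rightarrow> real \<Rightarrow> real \<Rightarrow> real \<Rightarrow> real \<Rightarrow> nat \<Rightarrow> real" where
  "mixture_term m c lam y t n =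
    poisson_weight lam t n * (gegenbauer_density (leg_shape m n) (y / (c * t)) / (c * t))"

text \<open>With r the square root, (1 - (y/(c t))^2)^((n-1)/2) is (r/(c t))^(n-1). The Poisson n!
  cancels Gamma(n + 1), 4^(n/2) supplies the 2 in lam/(2 c), and t drops out except in the
  exponential. Of n factors lam/(2 c), one forms the prefactor because r has exponent n - 1.\<close>

lemma mixture_term_0:
  assumes pos: "0 < c" "0 < lam" "0 < t" and y: "\<bar>y\<bar> < c * t"
  shows "mixture_term 0 c lam y t n = lam * exp (- (lam * t)) / (2 * c) *
      ((lam / (2 * c) * sqrt (c\<^sup>2 * t\<^sup>2 - y\<^sup>2)) powr (real n - 1) * (1 / (Gamma ((real n + 1) / 2))\<^sup>2))"
proof -
  define r where "r = sqrt (c\<^sup>2 * t\<^sup>2 - y\<^sup>2)"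
  define \<Gamma> where "\<Gamma> = Gamma ((real n + 1) / 2)"
  have "y\<^sup>2 < (c * t)\<^sup>2" using y by (simp add: abs_le_square_iff[symmetric] not_le[symmetric])
  then have r: "r > 0" "r\<^sup>2 = (c * t)\<^sup>2 - y\<^sup>2" by (auto simp: r_def power_mult_distrib)
  have ct: "c * t > 0" using pos by simp
  have \<Gamma>: "\<Gamma> > 0" unfolding \<Gamma>_def by (rule Gamma_real_pos) simp
  have "1 - (y / (c * t))\<^sup>2 = (r / (c * t)) powr 2"
    using r ct pos by (simp add: power_divide field_simps power_mult_distrib)
  then have "(1 - (y / (c * t))\<^sup>2) powr (real n / 2 - 1/2) = (r / (c * t)) powr (real n - 1)"
    by (simp only: powr_powr) (simp add: algebra_simps)
  also have "\<dots> = r powr (real n - 1) / ((c * t) ^ n / (c * t))"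
    using r ct by (simp add: powr_divide powr_diff powr_realpow)
  finally have 1: "(1 - (y / (c * t))\<^sup>2) powr (real n / 2 - 1/2) = r powr (real n - 1) / ((c * t) ^ n / (c * t))" .
  have "(lam / (2 * c) * r) powr (real n - 1) = (lam / (2 * c)) powr (real n - 1) * r powr (real n - 1)"
    by (rule powr_mult)
  also have "(lam / (2 * c)) powr (real n - 1) = (lam / (2 * c)) ^ n / (lam / (2 * c))"
    using pos by (simp add: powr_diff powr_realpow)
  finally have 2: "(lam / (2 * c) * r) powr (real n - 1) = (lam / (2 * c)) ^ n / (lam / (2 * c)) * r powr (real n - 1)" .
  have "(4 :: real) powr (real n / 2) = (2 powr 2) powr (real n / 2)" by simp
  also have "\<dots> = 2 ^ n" unfolding powr_powr by (simp add: powr_realpow)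
  finally have 3: "(4 :: real) powr (real n / 2) = 2 ^ n" .
  have 4: "Gamma (2 * (real n / 2) + 1) = fact n" by (simp add: Gamma_fact add.commute)
  have 5: "Gamma (real n / 2 + 1/2) = \<Gamma>" by (simp add: \<Gamma>_def add_divide_distrib)
  have 6: "\<bar>y / (c * t)\<bar> < 1" using y ct by (simp add: abs_divide)
  show ?thesis
    unfolding mixture_term_def gegenbauer_density_def leg_shape_def r_def[symmetric] \<Gamma>_def[symmetric]
      poisson_weight_def
    using 6 pos r \<Gamma> ct by (simp only: if_True refl 1 2 3 4 5) (simp add: field_simps)
qed

text \<open>Duplication reduces the constant to (n + 1)! / (sqrt pi Gamma(n + 3/2)), whose quotient
  by the Poisson n! leaves n + 1. The half-integer exponent of the series costs an extra sqrt(lam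
  t), compensated in the prefactor.\<close>

lemma mixture_term_1:
  assumes pos: "0 < c" "0 < lam" "0 < t" and y: "\<bar>y\<bar> < c * t"
  shows "mixture_term 1 c lam y t n = exp (- (lam * t)) / (c * sqrt (lam * pi * t ^ 3)) *
      ((lam / (c\<^sup>2 * t) * (c\<^sup>2 * t\<^sup>2 - y\<^sup>2)) powr (real n + 1/2) * ((real n + 1) / Gamma (real n + 3/2)))"
proof -
  define q where "q = c\<^sup>2 * t\<^sup>2 - y\<^sup>2"
  define \<Gamma> where "\<Gamma> = Gamma (real n + 3/2)"
  have "y\<^sup>2 < (c * t)\<^sup>2" using y by (simp add: abs_le_square_iff[symmetric] not_le[symmetric])
  then have q: "q > 0" by (auto simp: q_def power_mult_distrib)
  have ct: "c * t > 0" using pos by simp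
  have \<Gamma>: "\<Gamma> > 0" unfolding \<Gamma>_def by (rule Gamma_real_pos) simp
  define p where "p = real n + 1/2"
  define Q where "Q = (q / (c\<^sup>2 * t\<^sup>2)) powr p"
  have "1 - (y / (c * t))\<^sup>2 = q / (c\<^sup>2 * t\<^sup>2)"
    using pos by (simp add: q_def power_divide field_simps power_mult_distrib)
  then have 1: "(1 - (y / (c * t))\<^sup>2) powr (real n + 1 - 1/2) = Q"
    by (simp only:) (simp add: Q_def p_def add.commute)
  have "lam / (c\<^sup>2 * t) * q = (lam * t) * (q / (c\<^sup>2 * t\<^sup>2))"
    using pos by (simp add: field_simps power2_eq_square)
  then have "(lam / (c\<^sup>2 * t) * q) powr p = (lam * t) powr p * Q"
    unfolding Q_def by (simp only: powr_mult)
  also have "(lam * t) powr p = (lam * t) ^ n * sqrt (lam * t)"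
    using pos by (simp add: p_def powr_add powr_realpow powr_half_sqrt)
  finally have 2: "(lam / (c\<^sup>2 * t) * q) powr p = (lam * t) ^ n * sqrt (lam * t) * Q" .
  have 3: "(4 :: real) powr (real n + 1) = 4 ^ Suc n" by (simp add: powr_add powr_realpow)
  have "2 * (real n + 1) + 1 = 1 + real (2 * n + 2)" by simp
  then have 4: "Gamma (2 * (real n + 1) + 1) = fact (2 * n + 2)" by (simp only: Gamma_fact)
  have dup: "fact (2 * n + 2) = 4 ^ Suc n * \<Gamma> * fact (Suc n) / sqrt pi"
    using Gamma_half_integer_duplication[of n] by (simp add: \<Gamma>_def field_simps del: fact_Suc power_Suc)
  have 5: "Gamma (real n + 1 + 1/2) = \<Gamma>" by (simp add: \<Gamma>_def add_ac)
  have 6: "\<bar>y / (c * t)\<bar> < 1" using y ct by (simp add: abs_divide)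
  have "lam * pi * t ^ 3 = t\<^sup>2 * (lam * t) * pi" by (simp add: power2_eq_square power3_eq_cube)
  then have 7: "sqrt (lam * pi * t ^ 3) = t * sqrt (lam * t) * sqrt pi"
    using pos by (simp add: real_sqrt_mult)
  have sl: "sqrt (lam * t) > 0" using pos by simp
  have "mixture_term 1 c lam y t n = exp (- (lam * t)) * (lam * t) ^ n / fact n *
      (4 ^ Suc n * \<Gamma> * fact (Suc n) / sqrt pi / (4 ^ Suc n * \<Gamma>\<^sup>2) * Q / (c * t))"
    unfolding mixture_term_def gegenbauer_density_def leg_shape_def poisson_weight_def
    using 6 by (simp only: if_True one_neq_zero if_False 1 3 4 5 dup)
  also have "\<dots> = exp (- (lam * t)) / (c * (t * sqrt (lam * t) * sqrt pi)) *
      ((lam * t) ^ n * sqrt (lam * t) * Q * ((real n + 1) / \<Gamma>))"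
  proof -
    have "4 ^ Suc n * \<Gamma> * fact (Suc n) / sqrt pi / (4 ^ Suc n * \<Gamma>\<^sup>2) = (real n + 1) * fact n / (sqrt pi * \<Gamma>)"
    proof -
      have "P * \<Gamma> * F / w / (P * \<Gamma>\<^sup>2) = F / (w * \<Gamma>)" if "P > 0" for P F w :: real
        using that \<Gamma> by (simp add: power2_eq_square)
      from this[of "4 ^ Suc n" "fact (Suc n)" "sqrt pi"] show ?thesis
        by (simp add: add.commute[of 1] del: power_Suc)
    qed
    then show ?thesis
      using \<Gamma> sl pos by (simp only:) (simp add: field_simps)
  qed
  finally show ?thesis
    unfolding q_def[symmetric] \<Gamma>_def[symmetric] p_def[symmetric] 2 7 .
qed

text \<open>Summability is what allows the prefactor to be moved inside the series. It is taken as a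
  hypothesis because it will be known for almost every y from the finite total mass.\<close>

lemma flight_density_mixture:
  assumes "m \<in> {0, 1}" "0 < c" "0 < lam" "0 < t" and sum: "summable (mixture_term m c lam y t)"
  shows "flight_density m c lam y t = (\<Sum>n. mixture_term m c lam y t n)"
proof (cases "\<bar>y\<bar> < c * t")
  case y: True
  have suminf: "a * suminf f = (\<Sum>n. a * f n)" if "a \<noteq> 0" "summable (\<lambda>n. a * f n)" for a :: real and f
    using that by (subst suminf_mult) (auto simp: summable_cmult_iff)
  show ?thesis
  proof (cases "m = 0")
    case True
    have eq: "mixture_term m c lam y t = (\<lambda>n. lam * exp (- (lam * t)) / (2 * c) *
      ((lam / (2 * c) * sqrt (c\<^sup>2 * t\<^sup>2 - y\<^sup>2)) powr (real n - 1) * (1 / (Gamma ((real n + 1) / 2))\<^sup>2)))"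
      unfolding True using mixture_term_0[OF assms(2-4) y] by blast
    from suminf[OF _ sum[unfolded eq]] show ?thesis
      unfolding flight_density_def eq if_P[OF y] if_P[OF True] using assms(2-4) by simp
  next
    case False
    then have m: "m = 1" using assms(1) by simp
    have eq: "mixture_term m c lam y t = (\<lambda>n. exp (- (lam * t)) / (c * sqrt (lam * pi * t ^ 3)) *
      ((lam / (c\<^sup>2 * t) * (c\<^sup>2 * t\<^sup>2 - y\<^sup>2)) powr (real n + 1/2) * ((real n + 1) / Gamma (real n + 3/2))))"
      unfolding m using mixture_term_1[OF assms(2-4) y] by blast
    from suminf[OF _ sum[unfolded eq]] show ?thesis
      unfolding flight_density_def eq if_P[OF y] if_not_P[OF False] using assms(2-4) by simp
  qed
next
  case False
  then have "\<not> \<bar>y / (c * t)\<bar> < 1" using assms by (simp add: abs_divide abs_mult)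
  then have "mixture_term m c lam y t = (\<lambda>n. 0)"
    by (auto simp: mixture_term_def gegenbauer_density_def)
  then show ?thesis using False by (simp add: flight_density_def)
qed

lemma mixture_term_nonneg:
  "0 < c \<Longrightarrow> 0 < lam \<Longrightarrow> 0 < t \<Longrightarrow> 0 \<le> mixture_term m c lam y t n"
  unfolding mixture_term_def
  by (intro mult_nonneg_nonneg divide_nonneg_pos gegenbauer_density_nonneg) auto

lemma mixture_term_measurable [measurable]: "(\<lambda>y. mixture_term m c lam y t n) \<in> borel_measurable borel"
  unfolding mixture_term_def by measurable

lemma nn_integral_mixture_term:
  assumes pos: "0 < c" "0 < lam" "0 < t" and [measurable]: "f \<in> borel_measurable borel"
  shows "(\<integral>\<^sup>+ y. ennreal (mixture_term m c lam y t n) * f y \<partial>lborel)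
    = ennreal (poisson_weight lam t n) *
      (\<integral>\<^sup>+ w. ennreal (gegenbauer_density (leg_shape m n) w) * f (c * t * w) \<partial>lborel)"
proof -
  define g where "g = gegenbauer_density (leg_shape m n)"
  have g: "g w \<ge> 0" for w unfolding g_def by (rule gegenbauer_density_nonneg) simp
  have [measurable]: "g \<in> borel_measurable borel" unfolding g_def by measurable
  have ct: "c * t > 0" using pos by simp
  have "(\<integral>\<^sup>+ y. ennreal (mixture_term m c lam y t n) * f y \<partial>lborel)
      = ennreal (c * t) * (\<integral>\<^sup>+ w. ennreal (mixture_term m c lam (c * t * w) t n) * f (c * t * w) \<partial>lborel)"
    using ct by (subst nn_integral_real_affine[of _ "c * t" 0]) auto
  also have "\<dots> = (\<integral>\<^sup>+ w. ennreal (poisson_weight lam t n) * (ennreal (g w) * f (c * t * w)) \<partial>lborel)"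
  proof (subst nn_integral_cmult[symmetric], measurable, rule nn_integral_cong)
    fix w
    have "c * t * mixture_term m c lam (c * t * w) t n = poisson_weight lam t n * g w"
      using pos by (simp add: mixture_term_def g_def)
    then have "ennreal (c * t) * ennreal (mixture_term m c lam (c * t * w) t n)
        = ennreal (poisson_weight lam t n) * ennreal (g w)"
      using ct pos g mixture_term_nonneg[OF pos] by (simp flip: ennreal_mult)
    then show "ennreal (c * t) * (ennreal (mixture_term m c lam (c * t * w) t n) * f (c * t * w))
        = ennreal (poisson_weight lam t n) * (ennreal (g w) * f (c * t * w))"
      by (simp flip: mult.assoc)
  qed
  also have "\<dots> = ennreal (poisson_weight lam t n) * (\<integral>\<^sup>+ w. ennreal (g w) * f (c * t * w) \<partial>lborel)"
    by (rule nn_integral_cmult) measurable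
  finally show ?thesis by (simp add: g_def)
qed

lemma nn_integral_mixture:
  assumes pos: "0 < c" "0 < lam" "0 < t" and [measurable]: "f \<in> borel_measurable borel"
  shows "(\<integral>\<^sup>+ y. (\<Sum>n. ennreal (mixture_term m c lam y t n)) * f y \<partial>lborel)
    = (\<Sum>n. ennreal (poisson_weight lam t n) *
      (\<integral>\<^sup>+ w. ennreal (gegenbauer_density (leg_shape m n) w) * f (c * t * w) \<partial>lborel))"
proof -
  have "(\<integral>\<^sup>+ y. (\<Sum>n. ennreal (mixture_term m c lam y t n)) * f y \<partial>lborel)
      = (\<integral>\<^sup>+ y. (\<Sum>n. ennreal (mixture_term m c lam y t n) * f y) \<partial>lborel)"
    by simp
  also have "\<dots> = (\<Sum>n. \<integral>\<^sup>+ y. ennreal (mixture_term m c lam y t n) * f y \<partial>lborel)"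
    by (rule nn_integral_suminf) measurable
  finally show ?thesis by (simp add: nn_integral_mixture_term[OF pos])
qed

text \<open>Each term integrates to its Poisson weight, so the sum has mass 1 and is finite almost
  everywhere.\<close>

lemma mixture_finite:
  assumes pos: "0 < c" "0 < lam" "0 < t"
  shows "(\<integral>\<^sup>+ y. (\<Sum>n. ennreal (mixture_term m c lam y t n)) \<partial>lborel) = 1"
    and "AE y in lborel. summable (mixture_term m c lam y t)"
proof -
  show eq: "(\<integral>\<^sup>+ y. (\<Sum>n. ennreal (mixture_term m c lam y t n)) \<partial>lborel) = 1"
    using nn_integral_mixture[OF pos, of "\<lambda>_. 1" m] poisson_weight_suminf[OF pos(2,3)]
    by (simp add: gegenbauer_density_nn_integral)
  have "AE y in lborel. (\<Sum>n. ennreal (mixture_term m c lam y t n)) \<noteq> \<infinity>"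
    by (rule nn_integral_noteq_infinite) (auto simp: eq)
  then show "AE y in lborel. summable (mixture_term m c lam y t)"
    by eventually_elim (rule summable_suminf_not_top, auto simp: mixture_term_nonneg[OF pos])
qed

lemma flight_density_measurable [measurable]:
  "(\<lambda>y. flight_density m c lam y t) \<in> borel_measurable borel"
  unfolding flight_density_def by measurable

text \<open>At \<open>x = 0\<close> the integrand is not integrable and the left-hand side is the junk value \<open>0\<close>.\<close>

lemma exponential_time_kernel_integral:
  assumes m: "m \<in> {0, 1}" and pos: "0 < c" "0 < lam" "0 < t" and x: "x \<noteq> 0"
  shows "ennreal (LBINT y:{0<..<c * t}.
        t\<^sup>2 / (2 * y) * exp (- (t\<^sup>2 * \<bar>x\<bar> / y)) * folded_density m c lam y t)
    = (\<Sum>n. ennreal (poisson_weight lam t n) *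
      (\<integral>\<^sup>+ w. ennreal (gegenbauer_density (leg_shape m n) w) *
        (ennreal (t / (c * w) * exp (- (t * \<bar>x\<bar> / (c * w)))) * indicator {0<..} w) \<partial>lborel))"
proof -
  \<comment> \<open>The 1/2 of the kernel is already cancelled against the 2 in
    \<open>folded_density\<close>.\<close>
  define K where "K y = t\<^sup>2 / y * exp (- (t\<^sup>2 * \<bar>x\<bar> / y)) * indicator {0<..<c * t} y" for y
  define f where "f y = K y * flight_density m c lam y t" for y
  have [measurable]: "K \<in> borel_measurable borel" unfolding K_def[abs_def] by measurable
  have [measurable]: "f \<in> borel_measurable borel" unfolding f_def[abs_def] by measurable
  have ct: "c * t > 0" using pos by simp
  have K0: "0 \<le> K y" for y by (auto simp: K_def indicator_def)
  \<comment> \<open>From a exp(- a) \<le> 1 with a = t^2 \<bar>x\<bar> / y: a bound uniform in y, so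
    integrability is inherited from the flight density.\<close>
  have K_le: "K y \<le> 1 / \<bar>x\<bar>" for y
  proof (cases "0 < y")
    case True
    define a where "a = t\<^sup>2 * \<bar>x\<bar> / y"
    have a: "a > 0" using True x pos by (simp add: a_def)
    have "a \<le> exp a" using exp_ge_add_one_self[of a] by linarith
    then have "a * exp (- a) \<le> 1" by (simp add: exp_minus field_simps)
    then have "t\<^sup>2 / y * exp (- a) \<le> 1 / \<bar>x\<bar>"
      using x True by (simp add: a_def field_simps)
    then show ?thesis by (auto simp: K_def a_def indicator_def)
  qed (simp add: K_def)
  \<comment> \<open>At y = c t w the ratio t^2 / y is t / (c w). The cutoff y < c t may be dropped
    because the density vanishes for w \<ge> 1.\<close>
  have kernel: "ennreal (gegenbauer_density (leg_shape m n) w) * ennreal (K (c * t * w))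
      = ennreal (gegenbauer_density (leg_shape m n) w) *
        (ennreal (t / (c * w) * exp (- (t * \<bar>x\<bar> / (c * w)))) * indicator {0<..} w)" for n w
  proof (cases "0 < w \<and> w < 1")
    case True
    then have "0 < c * t * w" "c * t * w < c * t"
      using ct mult_strict_left_mono[of w 1 "c * t"] by auto
    then have "K (c * t * w) = t / (c * w) * exp (- (t * \<bar>x\<bar> / (c * w)))"
      using pos by (simp add: K_def power2_eq_square)
    then show ?thesis using True by simp
  next
    case False
    show ?thesis
    proof (cases "0 < w")
      case True
      then show ?thesis using False by (simp add: gegenbauer_density_def)
    next
      case False
      then have "\<not> 0 < c * t * w" using ct by (simp add: not_less mult_nonneg_nonpos)
      then show ?thesis using False by (simp add: K_def)
    qed
  qed
  have fl: "AE y in lborel. ennreal (flight_density m c lam y t) = (\<Sum>n. ennreal (mixture_term m c lam y t n))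
      \<and> 0 \<le> flight_density m c lam y t"
    using mixture_finite(2)[OF pos, of m]
  proof eventually_elim
    case (elim y)
    then show ?case
      using flight_density_mixture[OF m pos elim] mixture_term_nonneg[OF pos]
      by (simp add: suminf_ennreal2 suminf_nonneg)
  qed
  have "integrable lborel (\<lambda>y. flight_density m c lam y t)"
  proof (rule integrableI_nonneg)
    show "AE y in lborel. 0 \<le> flight_density m c lam y t" using fl by eventually_elim simp
    have "(\<integral>\<^sup>+ y. ennreal (flight_density m c lam y t) \<partial>lborel)
        = (\<integral>\<^sup>+ y. (\<Sum>n. ennreal (mixture_term m c lam y t n)) \<partial>lborel)"
      by (rule nn_integral_cong_AE) (use fl in eventually_elim, simp)
    then show "(\<integral>\<^sup>+ y. ennreal (flight_density m c lam y t) \<partial>lborel) < \<infinity>"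
      by (simp add: mixture_finite(1)[OF pos])
  qed measurable
  then have "integrable lborel (\<lambda>y. 1 / \<bar>x\<bar> * flight_density m c lam y t)" by simp
  then have f_int: "integrable lborel f"
  proof (rule Bochner_Integration.integrable_bound)
    show "AE y in lborel. norm (f y) \<le> norm (1 / \<bar>x\<bar> * flight_density m c lam y t)"
    proof (rule AE_I2)
      fix y
      have "K y * \<bar>flight_density m c lam y t\<bar> \<le> 1 / \<bar>x\<bar> * \<bar>flight_density m c lam y t\<bar>"
        by (intro mult_right_mono K_le) simp
      then show "norm (f y) \<le> norm (1 / \<bar>x\<bar> * flight_density m c lam y t)"
        using K0[of y] by (simp add: f_def abs_mult)
    qed
  qed measurable
  have "(LBINT y:{0<..<c * t}. t\<^sup>2 / (2 * y) * exp (- (t\<^sup>2 * \<bar>x\<bar> / y)) * folded_density m c lam y t)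
      = (LBINT y. f y)"
    unfolding set_lebesgue_integral_def f_def K_def folded_density_def
    by (rule Bochner_Integration.integral_cong[OF refl]) (auto simp: indicator_def)
  also have "ennreal (LBINT y. f y) = (\<integral>\<^sup>+ y. ennreal (f y) \<partial>lborel)"
    by (rule nn_integral_eq_integral[symmetric, OF f_int])
      (use fl in eventually_elim, simp add: f_def K0)
  also have "\<dots> = (\<integral>\<^sup>+ y. (\<Sum>n. ennreal (mixture_term m c lam y t n)) * ennreal (K y) \<partial>lborel)"
  proof (rule nn_integral_cong_AE, use fl in eventually_elim)
    fix y assume "ennreal (flight_density m c lam y t) = (\<Sum>n. ennreal (mixture_term m c lam y t n))
      \<and> 0 \<le> flight_density m c lam y t"
    then show "ennreal (f y) = (\<Sum>n. ennreal (mixture_term m c lam y t n)) * ennreal (K y)"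
      using K0[of y] by (simp add: f_def ennreal_mult mult.commute)
  qed
  also have "\<dots> = (\<Sum>n. ennreal (poisson_weight lam t n) *
      (\<integral>\<^sup>+ w. ennreal (gegenbauer_density (leg_shape m n) w) * ennreal (K (c * t * w)) \<partial>lborel))"
    by (rule nn_integral_mixture[OF pos]) measurable
  finally show ?thesis unfolding kernel .
qed

section \<open>Mixing over the exponential time\<close>

lemma exponential_time_scaling:
  assumes pos: "0 < c" "0 < t" and [measurable]: "A \<in> sets borel" and w: "w \<noteq> 0"
  shows "(\<integral>\<^sup>+ s. ennreal (exponential_density t s) * indicator A (c * s * w) \<partial>lborel)
    = (\<integral>\<^sup>+ x. ennreal (exponential_density t (x / (c * w)) / (c * \<bar>w\<bar>)) * indicator A x \<partial>lborel)"
proof -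
  have nn: "0 \<le> exponential_density t s" for s using pos by (simp add: exponential_density_def)
  have "(\<integral>\<^sup>+ s. ennreal (exponential_density t s) * indicator A (c * s * w) \<partial>lborel)
      = ennreal (1 / (c * \<bar>w\<bar>)) *
        (\<integral>\<^sup>+ x. ennreal (exponential_density t (x / (c * w))) * indicator A x \<partial>lborel)"
    using pos w by (subst nn_integral_real_affine[of _ "1 / (c * w)" 0]) (auto simp: abs_mult)
  also have "\<dots> = (\<integral>\<^sup>+ x. ennreal (exponential_density t (x / (c * w)) / (c * \<bar>w\<bar>)) * indicator A x \<partial>lborel)"
    using pos nn
    by (subst nn_integral_cmult[symmetric])
      (auto intro!: nn_integral_cong simp: ennreal_mult[symmetric] simp flip: mult.assoc)
  finally show ?thesis .
qed

text \<open>For fixed w the point c s w stays on one half-line, chosen by the sign of w. Evenness of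
  g pairs w with - w, and together they give an exponential profile on both half-lines, a function
  of \<bar>x\<bar>.\<close>

lemma exponential_time_symmetric_law:
  assumes pos: "0 < c" "0 < t" and [measurable]: "A \<in> sets borel"
    and [measurable]: "g \<in> borel_measurable borel" and even: "\<And>w. g (- w) = g w"
  shows "(\<integral>\<^sup>+ s. ennreal (exponential_density t s) * (\<integral>\<^sup>+ w. g w * indicator A (c * s * w) \<partial>lborel) \<partial>lborel)
    = (\<integral>\<^sup>+ x\<in>A. (\<integral>\<^sup>+ w. g w * (ennreal (t / (c * w) * exp (- (t * \<bar>x\<bar> / (c * w)))) * indicator {0<..} w) \<partial>lborel) \<partial>lborel)"
proof -
  define H where "H w = (\<integral>\<^sup>+ s. ennreal (exponential_density t s) * indicator A (c * s * w) \<partial>lborel)" for w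
  define k where "k x w = ennreal (t / (c * w) * exp (- (t * \<bar>x\<bar> / (c * w))))" for x w
  have [measurable]: "(\<lambda>(s, w). indicator A (c * s * w) :: ennreal) \<in> borel_measurable (borel \<Otimes>\<^sub>M borel)"
    by measurable
  have [measurable]: "H \<in> borel_measurable borel" unfolding H_def[abs_def] by measurable
  have H: "H w + H (- w) = (\<integral>\<^sup>+ x\<in>A. k x w \<partial>lborel)" if "0 < w" for w
  proof -
    have "H w + H (- w) = (\<integral>\<^sup>+ x. ennreal (exponential_density t (x / (c * w)) / (c * w)) * indicator A x
        + ennreal (exponential_density t (- x / (c * w)) / (c * w)) * indicator A x \<partial>lborel)"
      unfolding H_def using that
      by (subst (1 2) exponential_time_scaling[OF pos]) (auto simp: nn_integral_add)
    also have "\<dots> = (\<integral>\<^sup>+ x\<in>A. k x w \<partial>lborel)"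
    proof (rule nn_integral_cong_AE, use AE_lborel_singleton[of 0] in eventually_elim)
      \<comment> \<open>For x other than 0 exactly one of the two summands survives. At 0 both
        would, because \<open>exponential_density\<close> is positive there.\<close>
      fix x :: real assume "x \<noteq> 0"
      then show "ennreal (exponential_density t (x / (c * w)) / (c * w)) * indicator A x
        + ennreal (exponential_density t (- x / (c * w)) / (c * w)) * indicator A x = k x w * indicator A x"
      proof (cases "0 < x")
        case True
        then have "0 < x / (c * w)" "- x / (c * w) < 0" using that pos by simp_all
        then show ?thesis using True by (simp add: k_def exponential_density_def mult.commute)
      next
        case False
        then have "x / (c * w) < 0" "0 < - x / (c * w)"
          using that pos \<open>x \<noteq> 0\<close> by (simp_all add: divide_neg_pos)
        then show ?thesis using False by (simp add: k_def exponential_density_def mult.commute)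
      qed
    qed
    finally show ?thesis .
  qed
  have "(\<integral>\<^sup>+ s. ennreal (exponential_density t s) * (\<integral>\<^sup>+ w. g w * indicator A (c * s * w) \<partial>lborel) \<partial>lborel)
      = (\<integral>\<^sup>+ s. \<integral>\<^sup>+ w. ennreal (exponential_density t s) * (g w * indicator A (c * s * w)) \<partial>lborel \<partial>lborel)"
    by (simp add: nn_integral_cmult)
  also have "\<dots> = (\<integral>\<^sup>+ w. \<integral>\<^sup>+ s. ennreal (exponential_density t s) * (g w * indicator A (c * s * w)) \<partial>lborel \<partial>lborel)"
    by (rule lborel_pair.Fubini'[symmetric]) measurable
  also have "\<dots> = (\<integral>\<^sup>+ w. g w * H w \<partial>lborel)"
    unfolding H_def by (simp add: mult.left_commute nn_integral_cmult)
  also have "\<dots> = (\<integral>\<^sup>+ w. g w * H w * indicator {0<..} w + g w * H w * indicator {..<0} w \<partial>lborel)"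
    by (rule nn_integral_cong_AE, use AE_lborel_singleton[of 0] in eventually_elim) (auto simp: indicator_def)
  also have "\<dots> = (\<integral>\<^sup>+ w. g w * H w * indicator {0<..} w \<partial>lborel)
      + (\<integral>\<^sup>+ w. g w * H w * indicator {..<0} w \<partial>lborel)"
    by (rule nn_integral_add) measurable
  also have "(\<integral>\<^sup>+ w. g w * H w * indicator {..<0} w \<partial>lborel)
      = (\<integral>\<^sup>+ w. g w * H (- w) * indicator {0<..} w \<partial>lborel)"
    by (subst nn_integral_real_affine[of _ "-1" 0]) (auto simp: even indicator_def intro!: nn_integral_cong)
  also have "(\<integral>\<^sup>+ w. g w * H w * indicator {0<..} w \<partial>lborel)
      + (\<integral>\<^sup>+ w. g w * H (- w) * indicator {0<..} w \<partial>lborel)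
      = (\<integral>\<^sup>+ w. g w * (H w + H (- w)) * indicator {0<..} w \<partial>lborel)"
    by (subst nn_integral_add[symmetric]) (auto simp: distrib_left distrib_right)
  also have "\<dots> = (\<integral>\<^sup>+ w. \<integral>\<^sup>+ x. g w * (k x w * indicator {0<..} w) * indicator A x \<partial>lborel \<partial>lborel)"
  proof (rule nn_integral_cong)
    fix w :: real
    show "g w * (H w + H (- w)) * indicator {0<..} w
        = (\<integral>\<^sup>+ x. g w * (k x w * indicator {0<..} w) * indicator A x \<partial>lborel)"
    proof (cases "0 < w")
      case True
      have "(\<lambda>x. k x w) \<in> borel_measurable borel" unfolding k_def by measurable
      then show ?thesis using True by (simp add: H nn_integral_cmult mult.assoc)
    qed simp
  qed
  also have "\<dots> = (\<integral>\<^sup>+ x. \<integral>\<^sup>+ w. g w * (k x w * indicator {0<..} w) * indicator A x \<partial>lborel \<partial>lborel)"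
    unfolding k_def by (rule lborel_pair.Fubini') measurable
  also have "\<dots> = (\<integral>\<^sup>+ x\<in>A. (\<integral>\<^sup>+ w. g w * (k x w * indicator {0<..} w) \<partial>lborel) \<partial>lborel)"
    unfolding k_def by (intro nn_integral_cong nn_integral_multc) measurable
  finally show ?thesis unfolding k_def .
qed

theorem theorem4p6:
  fixes M :: "'a measure" and m :: nat and c lam t :: real
    and S \<theta> :: "nat \<Rightarrow> 'a \<Rightarrow> real" and T :: "'a \<Rightarrow> real"
  assumes "m \<in> {0, 1}" and "t > 0"
    and "random_flight M m c lam S \<theta>"
    and "distributed M lborel T (exponential_density t)"
    and "prob_space.indep_set M
           (sets (vimage_algebra (space M) T borel))
           (sets (vimage_algebra (space M)
             (\<lambda>\<omega>. \<lambda>s\<in>{0..}. (flight c S \<theta> s \<omega>, event_count S s \<omega>))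
             (Pi\<^sub>M {0..} (\<lambda>_. borel \<Otimes>\<^sub>M count_space UNIV))))"
    and "A \<in> sets borel"
  shows "prob_at_random_time M lam t (flight c S \<theta>) (event_count S) T A =
    (\<integral>\<^sup>+ x\<in>A. ennreal (LBINT y:{0<..<c * t}.
        t\<^sup>2 / (2 * y) * exp (- (t\<^sup>2 * \<bar>x\<bar> / y)) * folded_density m c lam y t) \<partial>lborel)"
proof -
  interpret random_flight M m c lam S \<theta> by fact
  note m = assms(1) and pos = c_pos rate_pos \<open>t > 0\<close>
  note [measurable] = \<open>A \<in> sets borel\<close>
  define g where "g n w = ennreal (gegenbauer_density (leg_shape m n) w)" for n w
  define k where "k x w = ennreal (t / (c * w) * exp (- (t * \<bar>x\<bar> / (c * w)))) * indicator {0<..} w" for x w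
  have [measurable]: "g n \<in> borel_measurable borel" for n unfolding g_def by measurable
  have [measurable]: "(\<lambda>(x, w). k x w) \<in> borel_measurable (borel \<Otimes>\<^sub>M borel)"
    unfolding k_def by measurable
  have T: "distr M borel T = density lborel (exponential_density t)"
    using distributed_distr_eq_density[OF assms(4)] by (simp cong: distr_cong)
  have cond: "cond_prob_at_random_time M (flight c S \<theta>) (event_count S) T n A
      = (\<integral>\<^sup>+ x\<in>A. (\<integral>\<^sup>+ w. g n w * k x w \<partial>lborel) \<partial>lborel)" for n
  proof -
    have "cond_prob_at_random_time M (flight c S \<theta>) (event_count S) T n A
        = (\<integral>\<^sup>+ s. (\<integral>\<^sup>+ w. g n w * indicator A (c * s * w) \<partial>lborel) \<partial>density lborel (exponential_density t))"
      unfolding cond_prob_at_random_time_def T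
    proof (rule nn_integral_cong_AE, subst AE_density, measurable,
        use AE_lborel_singleton[of 0] in eventually_elim, rule impI)
      \<comment> \<open>The conditional law is available for s > 0. Negative s have density 0, but
        at s = 0 the density is t, so that point is removed as a null set.\<close>
      fix s :: real assume "s \<noteq> 0" "0 < ennreal (exponential_density t s)"
      then have "0 < s" by (auto simp: exponential_density_def split: if_splits)
      then show "ennreal (\<P>(\<omega> in M. flight c S \<theta> s \<omega> \<in> A \<bar> event_count S s \<omega> = n))
          = (\<integral>\<^sup>+ w. g n w * indicator A (c * s * w) \<partial>lborel)"
        unfolding g_def by (rule cond_prob_flight[OF m]) measurable
    qed
    also have "\<dots> = (\<integral>\<^sup>+ s. ennreal (exponential_density t s) *
        (\<integral>\<^sup>+ w. g n w * indicator A (c * s * w) \<partial>lborel) \<partial>lborel)"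
      by (rule nn_integral_density) measurable
    also have "\<dots> = (\<integral>\<^sup>+ x\<in>A. (\<integral>\<^sup>+ w. g n w * k x w \<partial>lborel) \<partial>lborel)"
      unfolding k_def by (rule exponential_time_symmetric_law[OF pos(1,3)]) (auto simp: g_def)
    finally show ?thesis .
  qed
  have "prob_at_random_time M lam t (flight c S \<theta>) (event_count S) T A
      = (\<Sum>n. ennreal (poisson_weight lam t n) * (\<integral>\<^sup>+ x\<in>A. (\<integral>\<^sup>+ w. g n w * k x w \<partial>lborel) \<partial>lborel))"
    unfolding prob_at_random_time_def cond poisson_weight_def ..
  also have "\<dots> = (\<Sum>n. \<integral>\<^sup>+ x. ennreal (poisson_weight lam t n) * (\<integral>\<^sup>+ w. g n w * k x w \<partial>lborel) * indicator A x \<partial>lborel)"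
    by (simp add: nn_integral_cmult mult.assoc)
  also have "\<dots> = (\<integral>\<^sup>+ x. (\<Sum>n. ennreal (poisson_weight lam t n) * (\<integral>\<^sup>+ w. g n w * k x w \<partial>lborel) * indicator A x) \<partial>lborel)"
    by (rule nn_integral_suminf[symmetric]) measurable
  also have "\<dots> = (\<integral>\<^sup>+ x\<in>A. ennreal (LBINT y:{0<..<c * t}.
        t\<^sup>2 / (2 * y) * exp (- (t\<^sup>2 * \<bar>x\<bar> / y)) * folded_density m c lam y t) \<partial>lborel)"
  proof (rule nn_integral_cong_AE, use AE_lborel_singleton[of 0] in eventually_elim)
    \<comment> \<open>The point 0 is discarded because the kernel identity fails there; it is a null
      set for the outer integral.\<close>
    fix x :: real assume x: "x \<noteq> 0"
    show "(\<Sum>n. ennreal (poisson_weight lam t n) * (\<integral>\<^sup>+ w. g n w * k x w \<partial>lborel) * indicator A x)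
      = ennreal (LBINT y:{0<..<c * t}.
        t\<^sup>2 / (2 * y) * exp (- (t\<^sup>2 * \<bar>x\<bar> / y)) * folded_density m c lam y t) * indicator A x"
      unfolding exponential_time_kernel_integral[OF m pos x] g_def k_def by simp
  qed
  finally show ?thesis .
qed

end
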